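(* There are exactly 19 periodic isotopy classes of connected (proper) linear 3-periodic nets in $\mathbb{R}^3$ with adjacency depth 1 and a single vertex quotient graph.
   Context: A (proper) linear 3-periodic net in $\mathbb{R}^3$ is a pair $\mathcal{N}=(N,S)$ where (i) $S$, the set of edges, is a countable set of line segments $[p,q]$, $p\ne q$, which are essentially disjoint (two distinct segments meet at most in a common endpoint); (ii) $N$, the set of nodes, is the set of endpoints of members of $S$; (iii) there is a basis $\underline{a}=\{a_1,a_2,a_3\}$ of $\mathbb{R}^3$ such that $N$ and $S$ are invariant under the group $\mathcal{T}(\underline{a})$ of translations $T_k:x\mapsto x+k_1a_1+k_2a_2+k_3a_3$, $k\in\mathbb{Z}^3$; (iv) $N$ and $S$ partition into finitely many $\mathcal{T}(\underline{a})$-orbits. Such a basis is a periodicity basis; it is primitive if there is no periodicity basis $\underline{b}$ with $\mathcal{T}(\underline{a})$ a proper subset of $\mathcal{T}(\underline{b})$. The net is connected if its structure graph (vertices the nodes, edges the segments in $S$) is connected. The body $|\mathcal{N}|$ is the union of the segments in $S$. The labelled quotient graph $\mathrm{LQG}(\mathcal{N};\underline{a})$: its vertices correspond to $\mathcal{T}(\underline{a})$-orbits of nodes, with chosen representatives $p(v)$; its edges correspond to orbits of edges, and an edge $[T_kp(v),T_lp(w)]$ gives an edge directed from $v$ to $w$ labelled $k-l\in\mathbb{Z}^3$ ($(vw,m)$ being identified with $(wv,-m)$). (When there is a single vertex the labels, up to sign, do not depend on the representative.) The quotient graph of $\mathcal{N}$ is the unlabelled multigraph underlying $\mathrm{LQG}(\mathcal{N};\underline{a})$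 for a primitive periodicity basis $\underline{a}$. The depth of a labelled quotient graph is the maximum modulus of the coordinates of its edge labels; the adjacency depth $\nu(\mathcal{N})$ is the minimum of the depths of $\mathrm{LQG}(\mathcal{N};\underline{a})$ over all primitive periodicity bases $\underline{a}$. Proper linear 3-periodic nets $\mathcal{N}_0,\mathcal{N}_1$ are periodically isotopic if there is a family of proper linear 3-periodic nets $\mathcal{N}_t$, $0<t<1$, such that (a) there is a continuous path of bases $t\mapsto\underline{a}^t$ of $\mathbb{R}^3$, $0\le t\le1$, with $\underline{a}^t$ a right-handed periodicity basis for $\mathcal{N}_t$; (b) there are bijections $f_t:|\mathcal{N}_0|\to|\mathcal{N}_t|$, $0\le t\le1$, mapping nodes to nodes, such that $f_0$ is the identity, for each node $p$ of $\mathcal{N}_0$ the map $t\mapsto f_t(p)$ is continuous, and the restriction of $f_t$ to each edge $[a,b]$ is the affine map onto the edge $[f_t(a),f_t(b)]$ of $\mathcal{N}_t$ determined by linear interpolation. Periodic isotopy classes are the equivalence classes of this relation. *)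

theory Defs
  imports "HOL-Analysis.Analysis"
begin

type_synonym point = "real^3"

text \<open>A net is a pair consisting of its set of nodes and its set of edges; an edge is the
  point set of a closed line segment.\<close>
type_synonym net = "point set \<times> point set set"

abbreviation nodes :: "net \<Rightarrow> point set" where "nodes M \<equiv> fst M"
abbreviation edges :: "net \<Rightarrow> point set set" where "edges M \<equiv> snd M"

definition is_segment :: "point set \<Rightarrow> bool" where
  "is_segment e \<longleftrightarrow> (\<exists>p q. p \<noteq> q \<and> e = closed_segment p q)"

definition segment_ends :: "point set \<Rightarrow> point set" where
  "segment_ends e = {p. \<exists>q. e = closed_segment p q}"

lemma segment_ends_closed_segment [simp]:
  "segment_ends (closed_segment p q) = {p, q}"
  by (auto simp: segment_ends_def closed_segment_eq doubleton_eq_iff)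

definition essentially_disjoint :: "point set set \<Rightarrow> bool" where
  "essentially_disjoint S \<longleftrightarrow>
     (\<forall>e\<in>S. \<forall>e'\<in>S. e \<noteq> e' \<longrightarrow>
        e \<inter> e' = {} \<or> (\<exists>x. e \<inter> e' = {x} \<and> x \<in> segment_ends e \<and> x \<in> segment_ends e'))"


section \<open>Periodicity\<close>

text \<open>An ordered triple of vectors is encoded as the matrix \<open>a\<close> with rows \<open>a $ i\<close>, so that
  \<open>det a > 0\<close> says that the triple is right-handed.\<close>
definition is_basis :: "real^3^3 \<Rightarrow> bool" where
  "is_basis a \<longleftrightarrow> inj (\<lambda>i. a $ i) \<and> independent (range (\<lambda>i. a $ i)) \<and>
     span (range (\<lambda>i. a $ i)) = UNIV"

definition right_handed :: "real^3^3 \<Rightarrow> bool" where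
  "right_handed a \<longleftrightarrow> det a > 0"

definition translation :: "real^3^3 \<Rightarrow> int^3 \<Rightarrow> point \<Rightarrow> point" where
  "translation a k x = x + (\<Sum>i\<in>UNIV. of_int (k $ i) *\<^sub>R a $ i)"

definition translation_group :: "real^3^3 \<Rightarrow> (point \<Rightarrow> point) set" where
  "translation_group a = range (translation a)"

definition node_orbit :: "real^3^3 \<Rightarrow> point \<Rightarrow> point set" where
  "node_orbit a x = {g x | g. g \<in> translation_group a}"

definition edge_orbit :: "real^3^3 \<Rightarrow> point set \<Rightarrow> point set set" where
  "edge_orbit a e = {g ` e | g. g \<in> translation_group a}"

definition periodicity_basis :: "net \<Rightarrow> real^3^3 \<Rightarrow> bool" where
  "periodicity_basis M a \<longleftrightarrow> is_basis a \<and>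
     (\<forall>g\<in>translation_group a. g ` nodes M = nodes M \<and> (\<lambda>e. g ` e) ` edges M = edges M) \<and>
     finite (node_orbit a ` nodes M) \<and> finite (edge_orbit a ` edges M)"

definition primitive_basis :: "net \<Rightarrow> real^3^3 \<Rightarrow> bool" where
  "primitive_basis M a \<longleftrightarrow> periodicity_basis M a \<and>
     \<not> (\<exists>b. periodicity_basis M b \<and> translation_group a \<subset> translation_group b)"

definition linear_net :: "net \<Rightarrow> bool" where
  "linear_net M \<longleftrightarrow>
     countable (edges M) \<and> (\<forall>e\<in>edges M. is_segment e) \<and> essentially_disjoint (edges M) \<and>
     nodes M = (\<Union>e\<in>edges M. segment_ends e) \<and>
     (\<exists>a. periodicity_basis M a)"

definition net_body :: "net \<Rightarrow> point set" where
  "net_body M = \<Union>(edges M)"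

definition connected_net :: "net \<Rightarrow> bool" where
  "connected_net M \<longleftrightarrow>
     (\<forall>p\<in>nodes M. \<forall>q\<in>nodes M. (p, q) \<in> {(x, y). closed_segment x y \<in> edges M}\<^sup>*)"


section \<open>Labelled quotient graphs\<close>

record ('v, 'e) multigraph =
  gverts :: "'v set"
  gedges :: "'e set"
  gends :: "'e \<Rightarrow> 'v set"

text \<open>\<open>darts e\<close> is the set of all labelled directed versions of the edge \<open>e\<close>. Together
  with \<open>(v, w, m)\<close> it contains \<open>(w, v, -m)\<close>, which implements the identification of
  \<open>(vw, m)\<close> with \<open>(wv, -m)\<close>.\<close>
record ('v, 'e) labelled_multigraph =
  lverts :: "'v set"
  ledges :: "'e set"
  darts :: "'e \<Rightarrow> ('v \<times> 'v \<times> (int^3)) set"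

definition underlying_multigraph ::
    "('v, 'e) labelled_multigraph \<Rightarrow> ('v, 'e) multigraph" where
  "underlying_multigraph G =
     \<lparr> gverts = lverts G, gedges = ledges G,
       gends = (\<lambda>e. \<Union>{{v, w} | v w. \<exists>m. (v, w, m) \<in> darts G e}) \<rparr>"

definition representatives :: "net \<Rightarrow> real^3^3 \<Rightarrow> (point set \<Rightarrow> point) \<Rightarrow> bool" where
  "representatives M a r \<longleftrightarrow> (\<forall>v \<in> node_orbit a ` nodes M. r v \<in> v)"

definition LQG :: "net \<Rightarrow> real^3^3 \<Rightarrow> (point set \<Rightarrow> point) \<Rightarrow>
    (point set, point set set) labelled_multigraph" where
  "LQG M a r =
     \<lparr> lverts = node_orbit a ` nodes M,
       ledges = edge_orbit a ` edges M,
       darts = (\<lambda>E. {(v, w, k - l) | v w k l.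
          v \<in> node_orbit a ` nodes M \<and> w \<in> node_orbit a ` nodes M \<and>
          closed_segment (translation a k (r v)) (translation a l (r w)) \<in> E}) \<rparr>"

definition quotient_graph_of :: "net \<Rightarrow> (point set, point set set) multigraph \<Rightarrow> bool" where
  "quotient_graph_of M G \<longleftrightarrow>
     (\<exists>a r. primitive_basis M a \<and> representatives M a r \<and>
        G = underlying_multigraph (LQG M a r))"

definition depth :: "('v, 'e) labelled_multigraph \<Rightarrow> nat" where
  "depth G = Max {nat \<bar>m $ i\<bar> | e v w m i. e \<in> ledges G \<and> (v, w, m) \<in> darts G e}"

text \<open>For nets with several node orbits the depth depends on the representatives as well,
  so the minimum is also taken over these. (\<open>Inf\<close> of a nonempty set of natural numbers
  is its minimum.)\<close>
definition adjacency_depth :: "net \<Rightarrow> nat" where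
  "adjacency_depth M =
     Inf {depth (LQG M a r) | a r. primitive_basis M a \<and> representatives M a r}"


section \<open>Periodic isotopy\<close>

definition periodically_isotopic :: "net \<Rightarrow> net \<Rightarrow> bool" where
  "periodically_isotopic M0 M1 \<longleftrightarrow>
     (\<exists>(M :: real \<Rightarrow> net) (a :: real \<Rightarrow> real^3^3) (f :: real \<Rightarrow> point \<Rightarrow> point).
        M 0 = M0 \<and> M 1 = M1 \<and>
        (\<forall>t\<in>{0..1}. linear_net (M t)) \<and>
        continuous_on {0..1} a \<and>
        (\<forall>t\<in>{0..1}. periodicity_basis (M t) (a t) \<and> right_handed (a t)) \<and>
        (\<forall>t\<in>{0..1}. bij_betw (f t) (net_body M0) (net_body (M t)) \<and>
           f t ` nodes M0 \<subseteq> nodes (M t)) \<and>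
        (\<forall>x\<in>net_body M0. f 0 x = x) \<and>
        (\<forall>p\<in>nodes M0. continuous_on {0..1} (\<lambda>t. f t p)) \<and>
        (\<forall>t\<in>{0..1}. \<forall>p q. closed_segment p q \<in> edges M0 \<longrightarrow>
           closed_segment (f t p) (f t q) \<in> edges (M t) \<and>
           (\<forall>u\<in>{0..1}. f t ((1 - u) *\<^sub>R p + u *\<^sub>R q) = (1 - u) *\<^sub>R f t p + u *\<^sub>R f t q)))"

end

theory Submission
  imports Defs
begin

text \<open>
  A net with a single node orbit is a lattice translate \<open>p + L\<close> together with a finite set \<open>V = - V\<close>
  of vectors in \<open>L\<close>: from every node there is an edge along every vector of \<open>V\<close>. In coordinates
  with respect to a basis \<open>a\<close> of \<open>L\<close>, \<open>V\<close> is a set of integer vectors, namely the set of signed loop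
  labels of the labelled quotient graph; the net is then \<open>bouquet p a V\<close>. The proof computes the
  number of classes by passing from nets to such label sets.

  \<^item> Every primitive basis of such a net spans the same lattice \<open>L\<close>, so adjacency depth 1 says that
    for some basis of \<open>L\<close> all labels have coordinates in \<open>{-1, 0, 1}\<close>. For such labels the edges are
    essentially disjoint iff labels that agree modulo 2 agree up to sign: congruent labels give edges
    that cross at their midpoints, while for incongruent ones some 2 by 2 minor is \<open>1\<close> or \<open>-1\<close>, which
    forces the parameters of a common point to be integers. Connectedness says that \<open>V\<close> generates the
    lattice of integer vectors (\<open>target_nets_bouquet\<close>, \<open>bouquet_target_nets\<close>).

  \<^item> The isotopy class of \<open>bouquet p a V\<close> depends on \<open>V\<close> only, because bases of the same orientation
    can be deformed into each other, and \<open>- a\<close> describes the same net as \<open>a\<close>. A change of basis of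
    \<open>L\<close> replaces \<open>V\<close> by its image under a lattice automorphism. So equivalent label sets give the
    same class (\<open>isotopic_bouquet_equivalent\<close>).

  \<^item> There are seven nonzero classes modulo 2, and up to sign \<open>V\<close> contains at most one label from each;
    this leaves 1080 candidates. Nine explicit automorphisms suffice to decrease a certain weight of
    a generating candidate until one of 19 models is reached (\<open>equivalent_to_model\<close>).

  \<^item> An isotopy induces an isomorphism between the structure graphs at its two ends. The sizes of
    the balls of radius 1, 2 and 3 and the existence of triangles already distinguish the graphs of
    the 19 models (\<open>isotopic_standard_nets_signature\<close>, \<open>signatures_distinct\<close>).

  Invariance of the classes is proved without transitivity of isotopy. Concatenating two isotopies
  would require a common sublattice for two unrelated periodicity bases; instead, a path of affine
  maps that ends in the identity is applied to the given isotopy at each time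
  (\<open>isotopic_act_left\<close>).
\<close>

section \<open>Lattices and bouquets\<close>

(* Labels are triples and nets are pairs; quantifiers over them are better left unsplit. *)
declare split_paired_All [simp del] split_paired_Ex [simp del]

type_synonym ivec = "int \<times> int \<times> int"

text \<open>Triples of integers carry executable operations, which the finite checks below rely on.\<close>
definition ivec_of :: "int^3 \<Rightarrow> ivec" where
  "ivec_of k = (k $ 1, k $ 2, k $ 3)"

definition lat :: "real^3^3 \<Rightarrow> ivec \<Rightarrow> point" where
  "lat a k = (case k of (x, y, z) \<Rightarrow>
     of_int x *\<^sub>R a $ 1 + of_int y *\<^sub>R a $ 2 + of_int z *\<^sub>R a $ 3)"

text \<open>Every net with a single node orbit has this form with \<open>V = - V\<close>; each pair \<open>m, - m\<close> in \<open>V\<close> is then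
  a loop of the labelled quotient graph.\<close>
definition bouquet :: "point \<Rightarrow> real^3^3 \<Rightarrow> ivec set \<Rightarrow> net" where
  "bouquet p a V = (range (\<lambda>k. p + lat a k),
     {closed_segment (p + lat a k) (p + lat a (k + m)) | k m. m \<in> V})"

definition symmetric :: "ivec set \<Rightarrow> bool" where
  "symmetric V \<longleftrightarrow> (\<forall>v\<in>V. - v \<in> V)"

lemma bij_ivec_of: "bij ivec_of"
proof (rule bijI)
  show "inj ivec_of"
    by (rule injI) (auto simp: ivec_of_def vec_eq_iff forall_3)
  show "surj ivec_of"
  proof (rule surjI)
    fix k :: ivec
    show "ivec_of (vector [fst k, fst (snd k), snd (snd k)]) = k"
      by (simp add: ivec_of_def)
  qed
qed

lemma range_ivec_of: "range ivec_of = UNIV"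
  using bij_ivec_of by (simp add: bij_is_surj)

lemma ivec_of_diff: "ivec_of (k - l) = ivec_of k - ivec_of l"
  by (simp add: ivec_of_def)

lemma lat_add: "lat a (k + l) = lat a k + lat a l"
  by (cases k; cases l) (simp add: lat_def algebra_simps)

lemma lat_0 [simp]: "lat a 0 = 0"
  by (simp add: lat_def zero_prod_def)

lemma lat_minus: "lat a (- k) = - lat a k"
  by (cases k) (simp add: lat_def)

lemma lat_diff: "lat a (k - l) = lat a k - lat a l"
  by (cases k; cases l) (simp add: lat_def algebra_simps)

lemma range_uminus: "range (\<lambda>k. F (- k)) = range F" for F :: "ivec \<Rightarrow> 'b"
proof -
  have "range (\<lambda>k. F (- k)) = F ` range uminus" by (simp only: image_image)
  moreover have "range uminus = (UNIV :: ivec set)" by (rule surjI[of _ uminus]) simp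
  ultimately show ?thesis by simp
qed

lemma lat_uminus_basis: "lat (- a) k = lat a (- k)"
  by (cases k) (simp add: lat_def)

lemma translation_lat: "translation a k x = x + lat a (ivec_of k)"
  by (simp add: translation_def lat_def ivec_of_def sum_3)

lemma translation_group_lat: "translation_group a = range (\<lambda>k x. x + lat a k)"
proof -
  have "translation_group a = (\<lambda>k x. x + lat a k) ` range ivec_of"
    unfolding translation_group_def image_image by (simp add: translation_lat fun_eq_iff image_def)
  then show ?thesis by (simp add: range_ivec_of)
qed

lemma node_orbit_lat: "node_orbit a x = range (\<lambda>k. x + lat a k)"
  unfolding node_orbit_def translation_group_lat by auto

lemma edge_orbit_lat: "edge_orbit a e = range (\<lambda>k. (\<lambda>x. x + lat a k) ` e)"
  unfolding edge_orbit_def translation_group_lat by auto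

lemma is_basis_det: "is_basis a \<longleftrightarrow> det a \<noteq> 0"
proof -
  have rows: "range (\<lambda>i. a $ i) = rows a"
    by (auto simp: rows_def row_def)
  have 1: "span (rows a) = UNIV \<longleftrightarrow> det a \<noteq> 0"
    by (metis matrix_left_invertible_span_rows invertible_det_nz invertible_left_inverse invertible_right_inverse)
  have "det a \<noteq> 0 \<Longrightarrow> independent (rows a)"
    using det_dependent_rows[of a] by (auto simp: dependent_vec_eq)
  moreover have "inj (\<lambda>i. a $ i)" if "det a \<noteq> 0"
  proof (rule injI, rule ccontr)
    fix i j assume "a $ i = a $ j" "i \<noteq> j"
    then have "det a = 0"
      by (intro det_identical_rows[of i j]) (auto simp: row_def)
    with that show False by simp
  qed
  ultimately show ?thesis
    unfolding is_basis_def rows using 1 by auto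
qed

lemma coordinates_unique:
  fixes a :: "real^3^3"
  assumes "det a \<noteq> 0" and "x *\<^sub>R a $ 1 + y *\<^sub>R a $ 2 + z *\<^sub>R a $ 3 = 0"
  shows "x = 0 \<and> y = 0 \<and> z = 0"
proof -
  define c :: "3 \<Rightarrow> real" where "c i = (if i = 1 then x else if i = 2 then y else z)" for i
  have "(\<Sum>i\<in>UNIV. c i *s row i a) = 0"
    using assms(2) by (simp add: sum_3 c_def row_def scalar_mult_eq_scaleR)
  moreover have "\<exists>B. a ** B = mat 1"
    using assms(1) by (metis invertible_det_nz invertible_left_inverse invertible_right_inverse)
  ultimately have "\<forall>i. c i = 0"
    using matrix_right_invertible_independent_rows[of a] by blast
  from this[rule_format, of 1] this[rule_format, of 2] this[rule_format, of 3]
  show ?thesis by (simp add: c_def)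
qed

lemma lat_eq_0_iff:
  assumes "det a \<noteq> 0" shows "lat a k = 0 \<longleftrightarrow> k = 0"
proof (cases k)
  case (fields x y z)
  show ?thesis
  proof
    assume "lat a k = 0"
    then show "k = 0"
      using coordinates_unique[OF assms, of "of_int x" "of_int y" "of_int z"]
      by (simp add: lat_def fields zero_prod_def)
  qed simp
qed

lemma lat_inj:
  assumes "det a \<noteq> 0" shows "lat a k = lat a l \<longleftrightarrow> k = l"
  using lat_eq_0_iff[OF assms, of "k - l"] by (simp add: lat_diff)

lemma nodes_bouquet: "nodes (bouquet p a V) = range (\<lambda>k. p + lat a k)"
  by (simp add: bouquet_def)

lemma edges_bouquet:
  "edges (bouquet p a V) = {closed_segment (p + lat a k) (p + lat a (k + m)) | k m. m \<in> V}"
  by (simp add: bouquet_def)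

lemma edge_in_bouquet:
  assumes "det a \<noteq> 0" "symmetric V"
  shows "closed_segment (p + lat a k) (p + lat a l) \<in> edges (bouquet p a V) \<longleftrightarrow> l - k \<in> V"
proof
  assume "closed_segment (p + lat a k) (p + lat a l) \<in> edges (bouquet p a V)"
  then obtain k' m where m: "m \<in> V"
    and "closed_segment (p + lat a k) (p + lat a l)
       = closed_segment (p + lat a k') (p + lat a (k' + m))"
    unfolding edges_bouquet by auto
  then have "k = k' \<and> l = k' + m \<or> k = k' + m \<and> l = k'"
    using lat_inj[OF assms(1)] by (auto simp: closed_segment_eq doubleton_eq_iff)
  then show "l - k \<in> V"
    using m assms(2) by (auto simp: symmetric_def)
next
  assume "l - k \<in> V"
  then show "closed_segment (p + lat a k) (p + lat a l) \<in> edges (bouquet p a V)"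
    unfolding edges_bouquet by (intro CollectI exI[of _ k] exI[of _ "l - k"]) simp
qed

lemma edge_of_bouquetE:
  assumes "closed_segment x y \<in> edges (bouquet p a V)" "symmetric V"
  obtains k m where "x = p + lat a k" "y = p + lat a (k + m)" "m \<in> V"
proof -
  from assms(1) obtain k m where m: "m \<in> V"
    and "closed_segment x y = closed_segment (p + lat a k) (p + lat a (k + m))"
    unfolding edges_bouquet by auto
  then consider "x = p + lat a k" "y = p + lat a (k + m)"
    | "x = p + lat a (k + m)" "y = p + lat a k"
    by (auto simp: closed_segment_eq doubleton_eq_iff)
  then show thesis
  proof cases
    case 1 then show ?thesis using m that by blast
  next
    case 2 then show ?thesis
      using that[of "k + m" "- m"] m assms(2) by (auto simp: symmetric_def)
  qed
qed

lemma translate_segment: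
  "(\<lambda>x. x + c) ` closed_segment p q = closed_segment (p + c) (q + c)" for c :: point
  using closed_segment_translation[of c p q] by (simp add: add.commute)

text \<open>Point reflection maps a bouquet to itself. This is why the orientation of the basis is irrelevant to
  the isotopy class, although isotopies use right-handed bases only.\<close>
lemma bouquet_uminus_basis:
  assumes "symmetric V"
  shows "bouquet p (- a) V = bouquet p a V"
proof -
  have mem: "- m \<in> V \<longleftrightarrow> m \<in> V" for m
    using assms by (metis symmetric_def minus_minus)
  have "range (\<lambda>k. p + lat a (- k)) = range (\<lambda>k. p + lat a k)"
    by (rule range_uminus)
  moreover have "{closed_segment (p + lat a (- k)) (p + lat a (- (k + m))) | k m. m \<in> V}
    = {closed_segment (p + lat a k) (p + lat a (k + m)) | k m. m \<in> V}" (is "?L = ?R")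
  proof safe
    fix k m assume "m \<in> V"
    then show "\<exists>k' m'. closed_segment (p + lat a (- k)) (p + lat a (- (k + m)))
       = closed_segment (p + lat a k') (p + lat a (k' + m')) \<and> m' \<in> V"
      by - (rule exI[of _ "- k"], rule exI[of _ "- m"], simp add: mem)
  next
    fix k m assume "m \<in> V"
    then show "\<exists>k' m'. closed_segment (p + lat a k) (p + lat a (k + m))
       = closed_segment (p + lat a (- k')) (p + lat a (- (k' + m'))) \<and> m' \<in> V"
      by - (rule exI[of _ "- k"], rule exI[of _ "- m"], simp add: mem add.commute)
  qed
  ultimately show ?thesis
    by (simp add: bouquet_def lat_uminus_basis)
qed

section \<open>Isotopies and affine maps\<close>
definition act :: "(point \<Rightarrow> point) \<Rightarrow> net \<Rightarrow> net" where
  "act g M = (g ` nodes M, (\<lambda>e. g ` e) ` edges M)"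

definition aff :: "point \<Rightarrow> real^3^3 \<Rightarrow> point \<Rightarrow> point" where
  "aff b G x = b + G *v x"

text \<open>Translation vectors are the rows of \<open>a\<close>, so a linear map acts on \<open>a\<close> row by row.\<close>
definition push :: "real^3^3 \<Rightarrow> real^3^3 \<Rightarrow> real^3^3" where
  "push G a = (\<chi> i. G *v (a $ i))"

lemma push_eq: "push G a = a ** transpose G"
  by (simp add: push_def vec_eq_iff matrix_matrix_mult_def matrix_vector_mult_def transpose_def mult.commute)

lemma det_push: "det (push G a) = det G * det a"
  by (simp add: push_eq det_mul)

lemma lat_push: "lat (push G a) k = G *v lat a k"
  by (cases k) (simp add: lat_def push_def matrix_vector_right_distrib matrix_vector_mult_scaleR)

lemma aff_add_lat: "aff b G (x + lat a k) = aff b G x + lat (push G a) k"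
  by (simp add: aff_def lat_push matrix_vector_right_distrib)

lemma inj_aff: assumes "det G \<noteq> 0" shows "inj (aff b G)"
proof (rule injI)
  fix x y assume "aff b G x = aff b G y"
  then have "G *v x = G *v y" by (simp add: aff_def)
  then show "x = y"
    using assms by (metis invertible_det_nz inj_matrix_vector_mult injD)
qed

lemma aff_combination:
  "aff b G ((1 - u) *\<^sub>R p + u *\<^sub>R q) = (1 - u) *\<^sub>R aff b G p + u *\<^sub>R aff b G q"
  by (simp add: aff_def matrix_vector_right_distrib matrix_vector_mult_scaleR algebra_simps
      flip: scaleR_add_left)

lemma aff_segment: "aff b G ` closed_segment p q = closed_segment (aff b G p) (aff b G q)"
  unfolding closed_segment_def by (auto simp flip: aff_combination)

lemma act_bouquet: "act (aff b G) (bouquet p a V) = bouquet (aff b G p) (push G a) V"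
proof -
  have "(\<lambda>e. aff b G ` e) ` {closed_segment (p + lat a k) (p + lat a (k + m)) | k m. m \<in> V}
     = {aff b G ` closed_segment (p + lat a k) (p + lat a (k + m)) | k m. m \<in> V}"
    by blast
  then show ?thesis
    by (simp add: act_def bouquet_def image_image aff_segment aff_add_lat)
qed

lemma net_body_act: "net_body (act g M) = g ` net_body M"
  by (auto simp: net_body_def act_def)

lemma periodicity_basis_lat:
  "periodicity_basis M a \<longleftrightarrow> det a \<noteq> 0 \<and>
     (\<forall>k. (\<lambda>x. x + lat a k) ` nodes M = nodes M \<and>
          (\<lambda>e. (\<lambda>x. x + lat a k) ` e) ` edges M = edges M) \<and>
     finite (node_orbit a ` nodes M) \<and> finite (edge_orbit a ` edges M)"
  by (simp add: periodicity_basis_def is_basis_det translation_group_lat del: split_paired_All)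

lemma periodicity_basis_act:
  assumes G: "det G \<noteq> 0" and a: "periodicity_basis M a"
  shows "periodicity_basis (act (aff b G) M) (push G a)"
proof -
  let ?g = "aff b G"
  have tr: "(\<lambda>x. x + lat (push G a) k) ` ?g ` X = ?g ` (\<lambda>x. x + lat a k) ` X" for k X
    by (simp add: image_image aff_add_lat)
  have n: "(\<lambda>x. x + lat a k) ` nodes M = nodes M"
   and e: "(\<lambda>e. (\<lambda>x. x + lat a k) ` e) ` edges M = edges M" for k
    using a by (simp_all add: periodicity_basis_lat del: split_paired_All)
  have "node_orbit (push G a) (?g x) = ?g ` node_orbit a x" for x
    by (simp add: node_orbit_lat image_image aff_add_lat)
  then have fn: "node_orbit (push G a) ` nodes (act ?g M) = (\<lambda>X. ?g ` X) ` node_orbit a ` nodes M"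
    by (simp add: act_def image_image)
  have "edge_orbit (push G a) (?g ` X) = (\<lambda>X. ?g ` X) ` edge_orbit a X" for X
    by (simp add: edge_orbit_lat image_image aff_add_lat)
  then have fe: "edge_orbit (push G a) ` edges (act ?g M)
      = (\<lambda>Y. (\<lambda>X. ?g ` X) ` Y) ` edge_orbit a ` edges M"
    by (simp add: act_def image_image)
  have "(\<lambda>x. x + lat (push G a) k) ` nodes (act ?g M) = nodes (act ?g M)" for k
    using n[of k] by (simp add: act_def tr)
  moreover have "(\<lambda>e. (\<lambda>x. x + lat (push G a) k) ` e) ` edges (act ?g M) = edges (act ?g M)" for k
  proof -
    have "(\<lambda>e. (\<lambda>x. x + lat (push G a) k) ` e) ` edges (act ?g M)
       = (\<lambda>e. ?g ` e) ` (\<lambda>e. (\<lambda>x. x + lat a k) ` e) ` edges M"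
      unfolding act_def snd_conv image_image[of "\<lambda>e. (\<lambda>x. x + _) ` e"]
        image_image[of "\<lambda>e. ?g ` e"] tr ..
    then show ?thesis by (simp only: e) (simp add: act_def)
  qed
  ultimately show ?thesis
    using a G unfolding periodicity_basis_lat fn fe
    by (auto simp: det_push simp del: split_paired_All)
qed

lemma linear_net_act:
  assumes G: "det G \<noteq> 0" and M: "linear_net M"
  shows "linear_net (act (aff b G) M)"
proof -
  let ?g = "aff b G"
  have inj: "inj ?g" by (rule inj_aff[OF G])
  have seg: "\<exists>p q. p \<noteq> q \<and> e = closed_segment p q" if "e \<in> edges M" for e
    using M that by (auto simp: linear_net_def is_segment_def)
  have ends: "segment_ends (?g ` e) = ?g ` segment_ends e" if "e \<in> edges M" for e
    using seg[OF that] by (auto simp: aff_segment)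
  have "is_segment (?g ` e)" if "e \<in> edges M" for e
    using seg[OF that] inj by (metis is_segment_def aff_segment injD)
  moreover have "essentially_disjoint (edges (act ?g M))"
    unfolding essentially_disjoint_def
  proof (intro ballI impI)
    fix e e' assume "e \<in> edges (act ?g M)" "e' \<in> edges (act ?g M)" "e \<noteq> e'"
    then obtain d d' where d: "d \<in> edges M" "d' \<in> edges M" "d \<noteq> d'" "e = ?g ` d" "e' = ?g ` d'"
      by (auto simp: act_def)
    then have "d \<inter> d' = {} \<or> (\<exists>x. d \<inter> d' = {x} \<and> x \<in> segment_ends d \<and> x \<in> segment_ends d')"
      using M by (auto simp: linear_net_def essentially_disjoint_def)
    moreover have "e \<inter> e' = ?g ` (d \<inter> d')"
      using inj d by (simp add: image_Int)
    ultimately show "e \<inter> e' = {} \<or> (\<exists>x. e \<inter> e' = {x} \<and> x \<in> segment_ends e \<and> x \<in> segment_ends e')"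
      using d ends by auto
  qed
  moreover have "nodes (act ?g M) = (\<Union>e\<in>edges (act ?g M). segment_ends e)"
  proof -
    have "nodes (act ?g M) = ?g ` (\<Union>e\<in>edges M. segment_ends e)"
      using M by (simp add: act_def linear_net_def)
    then show ?thesis by (auto simp: act_def ends)
  qed
  moreover have "\<exists>a. periodicity_basis (act ?g M) a"
    using M periodicity_basis_act[OF G, of M] unfolding linear_net_def by blast
  ultimately show ?thesis
    using M by (auto simp: linear_net_def act_def)
qed

lemma act_id: assumes "\<And>x. g x = x" shows "act g M = M"
  using assms by (simp add: act_def image_def)

text \<open>If \<open>M\<^sub>t\<close> is an isotopy from \<open>M0\<close> to \<open>M1\<close> and \<open>g\<^sub>t\<close> is a path of orientation preserving affine maps
  with \<open>g\<^sub>1 = id\<close>, then \<open>g\<^sub>t M\<^sub>t\<close> is an isotopy from \<open>g\<^sub>0 M0\<close> to \<open>M1\<close>, with node maps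
  \<open>g\<^sub>t \<circ> f\<^sub>t \<circ> inv g\<^sub>0\<close>. The two deformations run simultaneously, so that no two periodicity bases
  of the same net have to be reconciled.\<close>
lemma isotopic_act_left:
  fixes b :: "real \<Rightarrow> point" and G :: "real \<Rightarrow> real^3^3"
  assumes iso: "periodically_isotopic M0 M1"
    and b: "continuous_on {0..1} b" and G: "continuous_on {0..1} G"
    and det: "\<And>t. t \<in> {0..1} \<Longrightarrow> det (G t) > 0"
    and b1: "b 1 = 0" and G1: "G 1 = mat 1"
  shows "periodically_isotopic (act (aff (b 0) (G 0)) M0) M1"
proof -
  obtain M :: "real \<Rightarrow> net" and a :: "real \<Rightarrow> real^3^3" and f :: "real \<Rightarrow> point \<Rightarrow> point" where M: "M 0 = M0" "M 1 = M1" "\<And>t. t \<in> {0..1} \<Longrightarrow> linear_net (M t)"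
    and a: "continuous_on {0..1} a"
      "\<And>t. t \<in> {0..1} \<Longrightarrow> periodicity_basis (M t) (a t) \<and> right_handed (a t)"
    and bij: "\<And>t. t \<in> {0..1} \<Longrightarrow> bij_betw (f t) (net_body M0) (net_body (M t))"
    and nod: "\<And>t. t \<in> {0..1} \<Longrightarrow> f t ` nodes M0 \<subseteq> nodes (M t)"
    and f0: "\<And>x. x \<in> net_body M0 \<Longrightarrow> f 0 x = x"
    and fc: "\<And>p. p \<in> nodes M0 \<Longrightarrow> continuous_on {0..1} (\<lambda>t. f t p)"
    and fe: "\<And>t p q. t \<in> {0..1} \<Longrightarrow> closed_segment p q \<in> edges M0 \<Longrightarrow>
           closed_segment (f t p) (f t q) \<in> edges (M t)"
    and fl: "\<And>t p q u. t \<in> {0..1} \<Longrightarrow> closed_segment p q \<in> edges M0 \<Longrightarrow> u \<in> {0..1} \<Longrightarrow>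
           f t ((1 - u) *\<^sub>R p + u *\<^sub>R q) = (1 - u) *\<^sub>R f t p + u *\<^sub>R f t q"
    using iso unfolding periodically_isotopic_def
    apply (elim exE conjE)
    subgoal for M a f by (rule that[of M a f]) (assumption | simp only: Ball_def simp_thms | meson)+
    done
  define g where "g t = aff (b t) (G t)" for t
  define h where "h = inv (g 0)"
  have inj: "inj (g t)" if "t \<in> {0..1}" for t
    unfolding g_def using det[OF that] by (intro inj_aff) simp
  have hg: "h (g 0 x) = x" for x
    unfolding h_def using inj[of 0] by simp
  have g1: "g 1 x = x" for x
    by (simp add: g_def aff_def b1 G1)
  have contm: "continuous_on {0..1} (\<lambda>t. G t *v z t)" if "continuous_on {0..1} z" for z :: "real \<Rightarrow> point"
    unfolding matrix_vector_mult_def using G that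
    by (intro continuous_intros continuous_on_vec_lambda) auto
  have contg: "continuous_on {0..1} (\<lambda>t. g t (z t))" if "continuous_on {0..1} z" for z :: "real \<Rightarrow> point"
    unfolding g_def aff_def by (intro continuous_on_add b contm that)
  show ?thesis
    unfolding periodically_isotopic_def
  proof (intro exI conjI)
    let ?M = "\<lambda>t. act (g t) (M t)" and ?a = "\<lambda>t. push (G t) (a t)" and ?f = "\<lambda>t x. g t (f t (h x))"
    let ?N = "act (aff (b 0) (G 0)) M0"
    have N: "?N = act (g 0) M0" by (simp add: g_def)
    show "?M 0 = ?N" by (simp add: N M)
    show "?M 1 = M1" using M act_id[OF g1] by simp
    show "\<forall>t\<in>{0..1}. linear_net (?M t)"
    proof
      fix t :: real assume t: "t \<in> {0..1}"
      show "linear_net (?M t)"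
        unfolding g_def using M(3)[OF t] det[OF t] by (intro linear_net_act) simp
    qed
    show "continuous_on {0..1} ?a"
      unfolding push_def using a(1)
      by (intro continuous_on_vec_lambda contm continuous_intros) auto
    show "\<forall>t\<in>{0..1}. periodicity_basis (?M t) (?a t) \<and> right_handed (?a t)"
    proof
      fix t :: real assume t: "t \<in> {0..1}"
      show "periodicity_basis (?M t) (?a t) \<and> right_handed (?a t)"
        using a(2)[OF t] det[OF t] periodicity_basis_act[of "G t" "M t" "a t" "b t"]
        by (simp add: g_def right_handed_def det_push)
    qed
    show "\<forall>t\<in>{0..1}. bij_betw (?f t) (net_body ?N) (net_body (?M t)) \<and> ?f t ` nodes ?N \<subseteq> nodes (?M t)"
    proof (intro ballI conjI)
      fix t :: real assume t: "t \<in> {0..1}"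
      have 1: "bij_betw h (net_body ?N) (net_body M0)"
        unfolding bij_betw_def inj_on_def N net_body_act by (auto simp: hg image_image)
      have 2: "bij_betw (g t) (net_body (M t)) (net_body (?M t))"
        using inj[OF t] by (auto simp: bij_betw_def net_body_act intro: inj_on_subset)
      show "bij_betw (?f t) (net_body ?N) (net_body (?M t))"
        using bij_betw_trans[OF bij_betw_trans[OF 1 bij[OF t]] 2] by (simp add: comp_def)
      show "?f t ` nodes ?N \<subseteq> nodes (?M t)"
        using nod[OF t] unfolding N by (auto simp: act_def hg)
    qed
    show "\<forall>x\<in>net_body ?N. ?f 0 x = x"
      unfolding N net_body_act by (auto simp: hg f0)
    show "\<forall>p\<in>nodes ?N. continuous_on {0..1} (\<lambda>t. ?f t p)"
      unfolding N by (auto simp: act_def hg intro!: contg fc)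
    show "\<forall>t\<in>{0..1}. \<forall>p q. closed_segment p q \<in> edges ?N \<longrightarrow>
           closed_segment (?f t p) (?f t q) \<in> edges (?M t) \<and>
           (\<forall>u\<in>{0..1}. ?f t ((1 - u) *\<^sub>R p + u *\<^sub>R q) = (1 - u) *\<^sub>R ?f t p + u *\<^sub>R ?f t q)"
    proof (intro ballI allI impI)
      fix t :: real and p q assume t: "t \<in> {0..1}" and "closed_segment p q \<in> edges ?N"
      then obtain e where e: "e \<in> edges M0" "closed_segment p q = g 0 ` e"
        unfolding N by (auto simp: act_def)
      then obtain x y where xy: "e = closed_segment x y"
        using M(1) M(3)[of 0] by (auto simp: linear_net_def is_segment_def)
      have "{p, q} = {g 0 x, g 0 y}"
        using e(2) by (simp add: xy g_def aff_segment closed_segment_eq)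
      then obtain x y where pq: "p = g 0 x" "q = g 0 y" and xy: "closed_segment x y \<in> edges M0"
        using e(1) xy by (metis closed_segment_commute doubleton_eq_iff)
      have 1: "closed_segment (?f t p) (?f t q) \<in> edges (?M t)"
      proof -
        have "closed_segment (?f t p) (?f t q) = g t ` closed_segment (f t x) (f t y)"
          by (simp add: pq hg) (simp add: g_def aff_segment)
        then show ?thesis using fe[OF t xy] by (simp add: act_def)
      qed
      have 2: "?f t ((1 - u) *\<^sub>R p + u *\<^sub>R q) = (1 - u) *\<^sub>R ?f t p + u *\<^sub>R ?f t q"
        if u: "u \<in> {0..1}" for u
      proof -
        have "(1 - u) *\<^sub>R p + u *\<^sub>R q = g 0 ((1 - u) *\<^sub>R x + u *\<^sub>R y)"
          by (simp add: pq g_def aff_combination)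
        then show ?thesis
          using fl[OF t xy u] by (simp add: hg pq) (simp add: g_def aff_combination)
      qed
      show "closed_segment (?f t p) (?f t q) \<in> edges (?M t) \<and>
           (\<forall>u\<in>{0..1}. ?f t ((1 - u) *\<^sub>R p + u *\<^sub>R q) = (1 - u) *\<^sub>R ?f t p + u *\<^sub>R ?f t q)"
        using 1 2 by blast
    qed
  qed
qed

lemma periodicity_basis_uminus: "periodicity_basis M (- a) \<longleftrightarrow> periodicity_basis M a"
proof -
  have "translation_group (- a) = translation_group a"
    unfolding translation_group_lat lat_uminus_basis by (rule range_uminus)
  moreover have "det (- a) = - det a"
    by (simp add: det_3)
  ultimately show ?thesis
    by (simp add: periodicity_basis_def node_orbit_def edge_orbit_def is_basis_det)
qed

text \<open>A periodicity basis can be made right-handed by changing the sign of all three vectors.\<close>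
lemma isotopic_refl:
  assumes "linear_net M" shows "periodically_isotopic M M"
proof -
  obtain a where a: "periodicity_basis M a" using assms by (auto simp: linear_net_def)
  have "det a \<noteq> 0" using a by (simp add: periodicity_basis_def is_basis_det)
  moreover have "det (- a) = - det a" by (simp add: det_3)
  ultimately obtain a' where "periodicity_basis M a'" "det a' > 0"
    using a periodicity_basis_uminus by (metis neg_0_less_iff_less linorder_neqE)
  then show ?thesis
    unfolding periodically_isotopic_def using assms
    by (intro exI[of _ "\<lambda>_. M"] exI[of _ "\<lambda>_. a'"] exI[of _ "\<lambda>_ x. x"])
       (auto simp: right_handed_def bij_betw_def)
qed

text \<open>The straight line from \<open>a'\<close> to \<open>a\<close> consists of bases, so it can be written as \<open>G\<^sub>t a\<close> for a path of
  linear maps \<open>G\<^sub>t\<close> of positive determinant with \<open>G\<^sub>1 = id\<close>.\<close>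
lemma isotopic_bouquet_path:
  assumes iso: "periodically_isotopic (bouquet p a V) N"
    and a: "det a \<noteq> 0"
    and det: "\<And>t. t \<in> {0..1} \<Longrightarrow> det ((1 - t) *\<^sub>R a' + t *\<^sub>R a) * det a > 0"
  shows "periodically_isotopic (bouquet p' a' V) N"
proof -
  obtain B where inv: "a ** B = mat 1" "B ** a = mat 1"
    using a by (auto simp: invertible_def simp flip: invertible_det_nz)
  define P where "P t = (1 - t) *\<^sub>R p' + t *\<^sub>R p" for t
  define A where "A t = (1 - t) *\<^sub>R a' + t *\<^sub>R a" for t
  \<comment> \<open>the linear map that sends the rows of \<open>a\<close> to the rows of \<open>A t\<close>\<close>
  define G where "G t = transpose (B ** A t)" for t
  define b where "b t = P t - G t *v p" for t
  have push: "push (G t) a = A t" for t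
    by (simp add: push_eq G_def matrix_mul_assoc inv)
  have aff: "aff (b t) (G t) p = P t" for t
    by (simp add: aff_def b_def)
  have cG: "continuous_on {0..1} G"
    unfolding G_def A_def transpose_def matrix_matrix_mult_def
    by (intro continuous_intros continuous_on_vec_lambda)
  have "continuous_on {0..1} b"
    unfolding b_def P_def matrix_vector_mult_def
    by (intro continuous_intros continuous_on_vec_lambda cG)
  moreover have "det (G t) > 0" if "t \<in> {0..1}" for t
  proof -
    have "det (G t) * det a = det (A t)"
      using det_push[of "G t" a] by (simp add: push)
    with det[OF that] have "0 < det (G t) * det a * det a"
      by (simp add: A_def)
    then show ?thesis using a by (simp add: mult.assoc zero_less_mult_iff)
  qed
  moreover have "G 1 = mat 1" by (simp add: G_def A_def inv transpose_mat)
  moreover from this have "b 1 = 0" by (simp add: b_def P_def)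
  ultimately have "periodically_isotopic (act (aff (b 0) (G 0)) (bouquet p a V)) N"
    using isotopic_act_left[OF iso _ cG, of b] by blast
  moreover have "act (aff (b 0) (G 0)) (bouquet p a V) = bouquet p' a' V"
    by (simp add: act_bouquet push aff) (simp add: P_def A_def)
  ultimately show ?thesis by simp
qed

section \<open>Deforming a basis\<close>
definition rows3 :: "point \<Rightarrow> point \<Rightarrow> point \<Rightarrow> real^3^3" where
  "rows3 x y z = vector [x, y, z]"

text \<open>The position \<open>p\<close> is quantified on both sides, so that it can be moved along with the basis.\<close>
definition interchangeable :: "ivec set \<Rightarrow> real^3^3 \<Rightarrow> real^3^3 \<Rightarrow> bool" where
  "interchangeable V a a' \<longleftrightarrow> (\<forall>p p' N.
     periodically_isotopic (bouquet p a V) N \<longleftrightarrow> periodically_isotopic (bouquet p' a' V) N)"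

lemma interchangeable_trans [trans]:
  "interchangeable V a b \<Longrightarrow> interchangeable V b c \<Longrightarrow> interchangeable V a c"
  unfolding interchangeable_def by blast

lemma interchangeable_line:
  assumes "\<And>t. t \<in> {0..1} \<Longrightarrow> det ((1 - t) *\<^sub>R a + t *\<^sub>R b) > 0"
  shows "interchangeable V a b"
proof -
  have a: "det a > 0" and b: "det b > 0"
    using assms[of 0] assms[of 1] by simp_all
  have "det ((1 - t) *\<^sub>R b + t *\<^sub>R a) > 0" if "t \<in> {0..1}" for t
    using assms[of "1 - t"] that by (simp add: add.commute)
  then show ?thesis
    unfolding interchangeable_def
    using a b assms isotopic_bouquet_path[of _ a V _ b] isotopic_bouquet_path[of _ b V _ a]
    by (metis less_irrefl mult_pos_pos)
qed

lemma det_rows3: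
  "det (rows3 x y z) = x$1 * y$2 * z$3 + x$2 * y$3 * z$1 + x$3 * y$1 * z$2
     - x$1 * y$3 * z$2 - x$2 * y$1 * z$3 - x$3 * y$2 * z$1"
  by (simp add: rows3_def det_3)

lemma convex_pos: "0 \<le> t \<Longrightarrow> t \<le> 1 \<Longrightarrow> x > 0 \<Longrightarrow> y > 0 \<Longrightarrow> (1 - t) * x + t * y > (0::real)"
  by (smt (verit) mult_nonneg_nonneg mult_pos_pos)

text \<open>The determinant is an affine function of each row. Hence a single row may be replaced by any vector
  on the same side of the plane spanned by the other two. The next lemmas reach the standard basis by
  such replacements only, which shows that the right-handed bases form a connected set.\<close>
lemma replace_row1:
  assumes "det (rows3 x y z) > 0" "det (rows3 x' y z) > 0"
  shows "interchangeable V (rows3 x y z) (rows3 x' y z)"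
proof (rule interchangeable_line)
  fix t :: real assume t: "t \<in> {0..1}"
  have "det ((1 - t) *\<^sub>R rows3 x y z + t *\<^sub>R rows3 x' y z)
     = (1 - t) * det (rows3 x y z) + t * det (rows3 x' y z)"
    by (simp add: rows3_def det_3) algebra
  then show "det ((1 - t) *\<^sub>R rows3 x y z + t *\<^sub>R rows3 x' y z) > 0"
    using assms t by (simp add: convex_pos)
qed

lemma replace_row2:
  assumes "det (rows3 x y z) > 0" "det (rows3 x y' z) > 0"
  shows "interchangeable V (rows3 x y z) (rows3 x y' z)"
proof (rule interchangeable_line)
  fix t :: real assume t: "t \<in> {0..1}"
  have "det ((1 - t) *\<^sub>R rows3 x y z + t *\<^sub>R rows3 x y' z)
     = (1 - t) * det (rows3 x y z) + t * det (rows3 x y' z)"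
    by (simp add: rows3_def det_3) algebra
  then show "det ((1 - t) *\<^sub>R rows3 x y z + t *\<^sub>R rows3 x y' z) > 0"
    using assms t by (simp add: convex_pos)
qed

lemma replace_row3:
  assumes "det (rows3 x y z) > 0" "det (rows3 x y z') > 0"
  shows "interchangeable V (rows3 x y z) (rows3 x y z')"
proof (rule interchangeable_line)
  fix t :: real assume t: "t \<in> {0..1}"
  have "det ((1 - t) *\<^sub>R rows3 x y z + t *\<^sub>R rows3 x y z')
     = (1 - t) * det (rows3 x y z) + t * det (rows3 x y z')"
    by (simp add: rows3_def det_3) algebra
  then show "det ((1 - t) *\<^sub>R rows3 x y z + t *\<^sub>R rows3 x y z') > 0"
    using assms t by (simp add: convex_pos)
qed

text \<open>Since \<open>e\<close> may lie on the wrong side to replace \<open>x\<close> directly, the row \<open>y\<close> is first replaced by \<open>e - x\<close> or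
  \<open>x - e\<close>, whichever has the right sign; afterwards \<open>e\<close> has coefficient 1 at \<open>x\<close>.\<close>
lemma exchange_row1_via_row2:
  assumes "det (rows3 x y z) > 0" and "det (rows3 x e z) \<noteq> 0"
  obtains y' where "det (rows3 e y' z) > 0" "interchangeable V (rows3 x y z) (rows3 e y' z)"
proof -
  define s where "s = sgn (det (rows3 x e z))"
  have "det (rows3 x (s *\<^sub>R (e - x)) z) = s * det (rows3 x e z)"
    by (simp add: det_rows3) algebra
  then have 1: "det (rows3 x (s *\<^sub>R (e - x)) z) > 0"
    using assms(2) by (auto simp: s_def sgn_if)
  have "det (rows3 e (s *\<^sub>R (e - x)) z) = s * det (rows3 x e z)"
    by (simp add: det_rows3) algebra
  then have 2: "det (rows3 e (s *\<^sub>R (e - x)) z) > 0"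
    using assms(2) by (auto simp: s_def sgn_if)
  show thesis
    using that[OF 2] replace_row2[OF assms(1) 1] replace_row1[OF 1 2] interchangeable_trans by blast
qed

lemma exchange_row1_via_row3:
  assumes "det (rows3 x y z) > 0" and "det (rows3 x y e) \<noteq> 0"
  obtains z' where "det (rows3 e y z') > 0" "interchangeable V (rows3 x y z) (rows3 e y z')"
proof -
  define s where "s = sgn (det (rows3 x y e))"
  have "det (rows3 x y (s *\<^sub>R (e - x))) = s * det (rows3 x y e)"
    by (simp add: det_rows3) algebra
  then have 1: "det (rows3 x y (s *\<^sub>R (e - x))) > 0"
    using assms(2) by (auto simp: s_def sgn_if)
  have "det (rows3 e y (s *\<^sub>R (e - x))) = s * det (rows3 x y e)"
    by (simp add: det_rows3) algebra
  then have 2: "det (rows3 e y (s *\<^sub>R (e - x))) > 0"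
    using assms(2) by (auto simp: s_def sgn_if)
  show thesis
    using that[OF 2] replace_row3[OF assms(1) 1] replace_row1[OF 1 2] interchangeable_trans by blast
qed

lemma exchange_row2_via_row3:
  assumes "det (rows3 x y z) > 0" and "det (rows3 x y e) \<noteq> 0"
  obtains z' where "det (rows3 x e z') > 0" "interchangeable V (rows3 x y z) (rows3 x e z')"
proof -
  define s where "s = sgn (det (rows3 x y e))"
  have "det (rows3 x y (s *\<^sub>R (e - y))) = s * det (rows3 x y e)"
    by (simp add: det_rows3) algebra
  then have 1: "det (rows3 x y (s *\<^sub>R (e - y))) > 0"
    using assms(2) by (auto simp: s_def sgn_if)
  have "det (rows3 x e (s *\<^sub>R (e - y))) = s * det (rows3 x y e)"
    by (simp add: det_rows3) algebra
  then have 2: "det (rows3 x e (s *\<^sub>R (e - y))) > 0"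
    using assms(2) by (auto simp: s_def sgn_if)
  show thesis
    using that[OF 2] replace_row3[OF assms(1) 1] replace_row2[OF 1 2] interchangeable_trans by blast
qed

lemma cramer_rows3:
  "det (rows3 x y z) * e $ i = det (rows3 e y z) * x $ i + det (rows3 x e z) * y $ i
     + det (rows3 x y e) * z $ i"
proof -
  have "\<forall>i. det (rows3 x y z) * e $ i = det (rows3 e y z) * x $ i + det (rows3 x e z) * y $ i
     + det (rows3 x y e) * z $ i"
    unfolding forall_3 det_rows3 by algebra
  then show ?thesis ..
qed

text \<open>The remaining case is that \<open>e\<close> is a negative multiple of \<open>x\<close>. Then \<open>x\<close> is first replaced by \<open>x + y\<close>,
  after which \<open>e\<close> has a nonzero coefficient at \<open>y\<close>.\<close>
lemma exchange_row1:
  assumes d: "det (rows3 x y z) > 0" and e: "e \<noteq> 0"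
  obtains y' z' where "det (rows3 e y' z') > 0" "interchangeable V (rows3 x y z) (rows3 e y' z')"
proof -
  consider "det (rows3 x e z) \<noteq> 0" | "det (rows3 x y e) \<noteq> 0"
    | "det (rows3 x e z) = 0" "det (rows3 x y e) = 0" "det (rows3 e y z) > 0"
    | "det (rows3 x e z) = 0" "det (rows3 x y e) = 0" "det (rows3 e y z) < 0"
    | "det (rows3 x e z) = 0" "det (rows3 x y e) = 0" "det (rows3 e y z) = 0"
    by linarith
  then show thesis
  proof cases
    case 1 then show ?thesis using exchange_row1_via_row2[OF d] that by blast
  next
    case 2 then show ?thesis using exchange_row1_via_row3[OF d] that by blast
  next
    case 3 then show ?thesis using replace_row1[OF d] that by blast
  next
    case 4
    have 5: "det (rows3 (x + y) y z) > 0"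
      using d by (simp add: det_rows3 algebra_simps)
    have "det (rows3 (x + y) e z) = det (rows3 x e z) - det (rows3 e y z)"
      by (simp add: det_rows3) algebra
    then have "det (rows3 (x + y) e z) \<noteq> 0" using 4 by simp
    then show ?thesis
      using exchange_row1_via_row2[OF 5] replace_row1[OF d 5] interchangeable_trans that by metis
  next
    case 5
    then have "e $ i = 0" for i using cramer_rows3[of x y z e i] d by simp
    then show ?thesis using e by (simp add: vec_eq_iff)
  qed
qed

lemma exchange_row2:
  assumes d: "det (rows3 x y z) > 0" and e: "\<And>c. e \<noteq> c *\<^sub>R x"
  obtains z' where "det (rows3 x e z') > 0" "interchangeable V (rows3 x y z) (rows3 x e z')"
proof -
  consider "det (rows3 x y e) \<noteq> 0" | "det (rows3 x y e) = 0" "det (rows3 x e z) > 0"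
    | "det (rows3 x y e) = 0" "det (rows3 x e z) < 0"
    | "det (rows3 x y e) = 0" "det (rows3 x e z) = 0"
    by linarith
  then show thesis
  proof cases
    case 1 then show ?thesis using exchange_row2_via_row3[OF d] that by blast
  next
    case 2 then show ?thesis using replace_row2[OF d] that by blast
  next
    case 3
    have 5: "det (rows3 x (y + z) z) > 0"
      using d by (simp add: det_rows3 algebra_simps)
    have "det (rows3 x (y + z) e) = det (rows3 x y e) - det (rows3 x e z)"
      by (simp add: det_rows3) algebra
    then have "det (rows3 x (y + z) e) \<noteq> 0" using 3 by simp
    then show ?thesis
      using exchange_row2_via_row3[OF 5] replace_row2[OF d 5] interchangeable_trans that by metis
  next
    case 4
    then have "e $ i = det (rows3 e y z) / det (rows3 x y z) * x $ i" for i
      using cramer_rows3[of x y z e i] d by (simp add: field_simps)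
    then have "e = (det (rows3 e y z) / det (rows3 x y z)) *\<^sub>R x" by (simp add: vec_eq_iff)
    then show ?thesis using e by blast
  qed
qed

lemma interchangeable_mat1:
  assumes "det a > 0" shows "interchangeable V a (mat 1)"
proof -
  let ?x = "vector [1, 0, 0] :: point" and ?y = "vector [0, 1, 0] :: point"
    and ?z = "vector [0, 0, 1] :: point"
  have a: "a = rows3 (a $ 1) (a $ 2) (a $ 3)"
    by (simp add: rows3_def vec_eq_iff forall_3)
  have one: "mat 1 = rows3 ?x ?y ?z"
    by (simp add: rows3_def vec_eq_iff forall_3 mat_def)
  have "?x \<noteq> 0" by (simp add: vec_eq_iff forall_3)
  then obtain y z where 1: "det (rows3 ?x y z) > 0" "interchangeable V a (rows3 ?x y z)"
    using exchange_row1[of "a $ 1" "a $ 2" "a $ 3" ?x V] assms a by metis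
  have "?y \<noteq> c *\<^sub>R ?x" for c by (simp add: vec_eq_iff forall_3)
  then obtain z where 2: "det (rows3 ?x ?y z) > 0" "interchangeable V a (rows3 ?x ?y z)"
    using exchange_row2[OF 1(1), of ?y V] 1(2) interchangeable_trans by metis
  have "det (rows3 ?x ?y ?z) > 0" by (simp add: det_rows3)
  then show ?thesis
    unfolding one using replace_row3[OF 2(1)] 2(2) interchangeable_trans by blast
qed

text \<open>The isotopy class of a bouquet depends on its label set only.\<close>
lemma isotopic_bouquet_iff_standard:
  assumes "det a \<noteq> 0" "symmetric V"
  shows "periodically_isotopic (bouquet p a V) N \<longleftrightarrow>
         periodically_isotopic (bouquet 0 (mat 1) V) N"
proof (cases "det a > 0")
  case True
  then show ?thesis using interchangeable_mat1[of a V] by (simp add: interchangeable_def)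
next
  case False
  moreover have "det (- a) = - det a" by (simp add: det_3)
  ultimately have "det (- a) > 0" using assms(1) by simp
  then show ?thesis
    using interchangeable_mat1[of "- a" V] bouquet_uminus_basis[OF assms(2)]
    by (simp add: interchangeable_def)
qed

section \<open>Change of lattice basis\<close>
definition lattice_aut :: "(ivec \<Rightarrow> ivec) \<Rightarrow> bool" where
  "lattice_aut u \<longleftrightarrow> bij u \<and> (\<forall>k l. u (k + l) = u k + u l)"

definition equivalent_labels :: "ivec set \<Rightarrow> ivec set \<Rightarrow> bool" where
  "equivalent_labels V W \<longleftrightarrow> (\<exists>u. lattice_aut u \<and> W = u ` V)"

lemma lattice_aut_add: "lattice_aut u \<Longrightarrow> u (k + l) = u k + u l"
  by (simp add: lattice_aut_def)

lemma lattice_aut_0: "lattice_aut u \<Longrightarrow> u 0 = 0"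
  using lattice_aut_add[of u 0 0] by simp

lemma lattice_aut_minus: "lattice_aut u \<Longrightarrow> u (- k) = - u k"
  using lattice_aut_add[of u k "- k"] lattice_aut_0[of u] by (simp add: eq_neg_iff_add_eq_0 add.commute)

lemma additive_scale:
  fixes h :: "ivec \<Rightarrow> 'b::real_vector"
  assumes add: "\<And>k l. h (k + l) = h k + h l"
  shows "h (x, y, z) = of_int x *\<^sub>R h (1,0,0) + of_int y *\<^sub>R h (0,1,0) + of_int z *\<^sub>R h (0,0,1)"
proof -
  have h0: "h 0 = 0" using add[of 0 0] by simp
  have neg: "h (- k) = - h k" for k
    using add[of k "- k"] h0 by (simp add: eq_neg_iff_add_eq_0 add.commute)
  define m where "m i k = (case k of (x, y, z) \<Rightarrow> (i * x, i * y, i * z))" for i :: int and k :: ivec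
  have nat: "h (m (int n) k) = real n *\<^sub>R h k" for n k
  proof (induction n)
    case 0
    then show ?case using h0 by (cases k) (simp add: m_def zero_prod_def)
  next
    case (Suc n)
    have "m (int (Suc n)) k = k + m (int n) k"
      by (cases k) (simp add: m_def algebra_simps)
    then show ?case using Suc by (simp add: add algebra_simps)
  qed
  have int: "h (m i k) = of_int i *\<^sub>R h k" for i k
  proof (cases i)
    case (nonneg n) then show ?thesis using nat by simp
  next
    case (neg n)
    have "m i k = - m (int (Suc n)) k" by (cases k) (simp add: m_def neg algebra_simps)
    then show ?thesis using nat[of "Suc n" k] by (simp add: \<open>\<And>k. h (- k) = - h k\<close> neg algebra_simps)
  qed
  have "(x, y, z) = m x (1,0,0) + m y (0,1,0) + m z (0,0,1)"
    by (simp add: m_def)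
  then show ?thesis by (simp only: add int)
qed

text \<open>Composing the coordinates with an automorphism amounts to choosing another basis \<open>a'\<close> of the same
  lattice. The vectors of \<open>a'\<close> are linearly independent because their span contains those of \<open>a\<close>.\<close>
lemma lat_lattice_aut:
  assumes u: "lattice_aut u" and a: "det a \<noteq> 0"
  obtains a' where "det a' \<noteq> 0" "\<And>k. lat a (u k) = lat a' k"
proof -
  define a' where "a' = rows3 (lat a (u (1,0,0))) (lat a (u (0,1,0))) (lat a (u (0,0,1)))"
  have eq: "lat a (u k) = lat a' k" for k
  proof (cases k)
    case (fields x y z)
    have "lat a (u (k + l)) = lat a (u k) + lat a (u l)" for k l
      by (simp add: lattice_aut_add[OF u] lat_add)
    from additive_scale[of "\<lambda>k. lat a (u k)", OF this, of x y z]
    show ?thesis by (simp add: fields a'_def rows3_def lat_def[of _ "(x, y, z)"])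
  qed
  have span: "lat a' k \<in> span (rows a')" for k
  proof (cases k)
    case (fields x y z)
    have "a' $ i \<in> rows a'" for i by (auto simp: rows_def row_def)
    then show ?thesis
      by (simp add: lat_def fields) (intro span_add span_scale span_base)
  qed
  have "a $ i \<in> span (rows a')" for i
  proof -
    have "\<forall>i. \<exists>k. a $ i = lat a k"
      unfolding forall_3
      by (intro conjI exI[of _ "(1,0,0)"] exI[of _ "(0,1,0)"] exI[of _ "(0,0,1)"]) (simp_all add: lat_def)
    then obtain k where "a $ i = lat a k" by blast
    moreover obtain l where "k = u l"
      using u by (metis lattice_aut_def bij_is_surj surjD)
    ultimately show ?thesis using span[of l] by (simp add: eq)
  qed
  then have "rows a \<subseteq> span (rows a')" by (auto simp: rows_def row_def)
  then have "span (rows a) \<subseteq> span (rows a')" by (rule span_minimal) (rule subspace_span)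
  moreover have "span (rows a) = UNIV"
    using a by (metis matrix_left_invertible_span_rows invertible_det_nz invertible_left_inverse)
  ultimately have "span (rows a') = UNIV" by blast
  then have "det a' \<noteq> 0"
    by (metis matrix_left_invertible_span_rows invertible_det_nz invertible_left_inverse)
  with eq that show thesis by blast
qed

lemma isotopic_bouquet_equivalent:
  assumes W: "equivalent_labels W V" and a: "det a \<noteq> 0" and sym: "symmetric W"
  shows "periodically_isotopic (bouquet p a V) N \<longleftrightarrow>
         periodically_isotopic (bouquet 0 (mat 1) W) N"
proof -
  from W obtain u where u: "lattice_aut u" and V: "V = u ` W"
    by (auto simp: equivalent_labels_def)
  obtain a' where a': "det a' \<noteq> 0" and lat: "\<And>k. lat a (u k) = lat a' k"
    using lat_lattice_aut[OF u a] by blast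
  have surj: "\<exists>l. k = u l" for k
    using u by (metis lattice_aut_def bij_is_surj surjD)
  have "range (\<lambda>k. p + lat a k) = range (\<lambda>k. p + lat a (u k))"
    using surj by (auto simp: image_iff) metis
  moreover have "{closed_segment (p + lat a k) (p + lat a (k + m)) | k m. m \<in> V}
     = {closed_segment (p + lat a (u k)) (p + lat a (u (k + m))) | k m. m \<in> W}"
    (is "?L = ?R")
  proof
    show "?L \<subseteq> ?R"
    proof
      fix e assume "e \<in> ?L"
      then obtain k m where "m \<in> W" "e = closed_segment (p + lat a k) (p + lat a (k + u m))"
        unfolding V by blast
      moreover obtain l where "k = u l" using surj by blast
      ultimately show "e \<in> ?R" unfolding lattice_aut_add[OF u] by blast
    qed
    show "?R \<subseteq> ?L" unfolding V lattice_aut_add[OF u] by blast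
  qed
  ultimately have "bouquet p a V = bouquet p a' W"
    by (simp add: bouquet_def lat)
  then show ?thesis using isotopic_bouquet_iff_standard[OF a' sym] by simp
qed

section \<open>Graph invariants of isotopy\<close>
lemma essentially_disjointD:
  assumes "essentially_disjoint S" "e \<in> S" "e' \<in> S" "z \<in> e" "z \<in> e'"
  shows "e = e' \<or> z \<in> segment_ends e \<and> z \<in> segment_ends e'"
proof (intro disjCI)
  assume "\<not> (z \<in> segment_ends e \<and> z \<in> segment_ends e')"
  moreover have z: "z \<in> e \<inter> e'" using assms(4,5) by (rule IntI)
  moreover have "e \<noteq> e' \<Longrightarrow>
      e \<inter> e' = {} \<or> (\<exists>x. e \<inter> e' = {x} \<and> x \<in> segment_ends e \<and> x \<in> segment_ends e')"
    using assms(1-3) unfolding essentially_disjoint_def by blast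
  ultimately show "e = e'" by (metis empty_iff singletonD)
qed

lemma linear_net_edgeE:
  assumes "linear_net M" "e \<in> edges M"
  obtains p q where "e = closed_segment p q" "p \<noteq> q" "p \<in> nodes M" "q \<in> nodes M"
proof -
  obtain p q where pq: "p \<noteq> q" "e = closed_segment p q"
    using assms by (auto simp: linear_net_def is_segment_def)
  moreover have "segment_ends e \<subseteq> nodes M"
    using assms by (auto simp: linear_net_def)
  ultimately show thesis using that[of p q] by simp
qed

lemma linear_net_edge_ends:
  assumes "linear_net M" "closed_segment x y \<in> edges M"
  shows "x \<noteq> y \<and> x \<in> nodes M \<and> y \<in> nodes M"
proof -
  obtain p q where "closed_segment x y = closed_segment p q" "p \<noteq> q" "p \<in> nodes M" "q \<in> nodes M"
    using linear_net_edgeE[OF assms] .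
  then show ?thesis by (auto simp: closed_segment_eq doubleton_eq_iff)
qed

lemma linear_net_nodeE:
  assumes "linear_net M" "x \<in> nodes M"
  obtains y where "closed_segment x y \<in> edges M"
proof -
  obtain e where e: "e \<in> edges M" "x \<in> segment_ends e"
    using assms by (auto simp: linear_net_def)
  then obtain y where "e = closed_segment x y" by (auto simp: segment_ends_def)
  with e that show thesis by blast
qed

definition graph_iso :: "(point \<Rightarrow> point) \<Rightarrow> net \<Rightarrow> net \<Rightarrow> bool" where
  "graph_iso h M M' \<longleftrightarrow> bij_betw h (nodes M) (nodes M') \<and>
     (\<forall>x\<in>nodes M. \<forall>y\<in>nodes M. closed_segment x y \<in> edges M \<longleftrightarrow> closed_segment (h x) (h y) \<in> edges M')"

text \<open>The maps of an isotopy are only required to map nodes into nodes and edges onto edges. Both are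
  hit completely: a node of \<open>M'\<close> lies on the image of some edge, and since edges meet in endpoints
  only, it is an endpoint of that image; similarly, the midpoint of an edge of \<open>M'\<close> identifies that
  edge as the image of an edge of \<open>M\<close>.\<close>
lemma body_isomorphism_graph_iso:
  assumes M: "linear_net M" and M': "linear_net M'"
    and bij: "bij_betw f (net_body M) (net_body M')"
    and nod: "f ` nodes M \<subseteq> nodes M'"
    and edge: "\<And>p q. closed_segment p q \<in> edges M \<Longrightarrow> closed_segment (f p) (f q) \<in> edges M'"
    and aff: "\<And>p q u. closed_segment p q \<in> edges M \<Longrightarrow> u \<in> {0..1} \<Longrightarrow>
           f ((1 - u) *\<^sub>R p + u *\<^sub>R q) = (1 - u) *\<^sub>R f p + u *\<^sub>R f q"
  shows "graph_iso f M M'"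
proof -
  have ed: "essentially_disjoint (edges M')" using M' by (simp add: linear_net_def)
  have nb: "x \<in> net_body M" if "x \<in> nodes M" for x
    using linear_net_nodeE[OF M that] by (metis UnionI ends_in_segment(1) net_body_def)
  have inj: "x = y" if "f x = f y" "x \<in> net_body M" "y \<in> net_body M" for x y
    using bij that by (auto simp: bij_betw_def inj_on_def)
  have cover: "\<exists>p q x. closed_segment p q \<in> edges M \<and> x \<in> closed_segment p q \<and> f x = y \<and>
      p \<in> nodes M \<and> q \<in> nodes M \<and> y \<in> closed_segment (f p) (f q)" if y: "y \<in> net_body M'" for y
  proof -
    obtain x where x: "x \<in> net_body M" "f x = y"
      using bij y by (metis bij_betw_imp_surj_on imageE)
    then obtain e where e: "e \<in> edges M" "x \<in> e" by (auto simp: net_body_def)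
    obtain p q where pq: "e = closed_segment p q" "p \<in> nodes M" "q \<in> nodes M"
      by (rule linear_net_edgeE[OF M e(1)])
    obtain u where u: "0 \<le> u" "u \<le> 1" "x = (1 - u) *\<^sub>R p + u *\<^sub>R q"
      using e(2) unfolding pq(1) in_segment by blast
    have "f x = (1 - u) *\<^sub>R f p + u *\<^sub>R f q"
      using aff[of p q u] e(1) u(1,2) unfolding pq(1) u(3) by simp
    then have "y \<in> closed_segment (f p) (f q)" using u(1,2) x(2) unfolding in_segment by blast
    then show ?thesis
      using e pq x by (intro exI[of _ p] exI[of _ q] exI[of _ x]) simp
  qed
  have "y \<in> f ` nodes M" if y: "y \<in> nodes M'" for y
  proof -
    obtain z where z: "closed_segment y z \<in> edges M'" using linear_net_nodeE[OF M' y] .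
    then have "y \<in> net_body M'" by (auto simp: net_body_def)
    then obtain p q x where pq: "closed_segment p q \<in> edges M" "p \<in> nodes M" "q \<in> nodes M"
      "y \<in> closed_segment (f p) (f q)"
      using cover by blast
    have "y \<in> segment_ends (closed_segment (f p) (f q))"
      using essentially_disjointD[OF ed z edge[OF pq(1)], of y] pq(4)
      by (metis insertI1 segment_ends_closed_segment ends_in_segment(1))
    then show ?thesis using pq(2,3) by auto
  qed
  then have 1: "bij_betw f (nodes M) (nodes M')"
    unfolding bij_betw_def
  proof (intro conjI)
    show "inj_on f (nodes M)" by (rule inj_onI) (rule inj[OF _ nb nb])
    show "f ` nodes M = nodes M'" using nod \<open>\<And>y. y \<in> nodes M' \<Longrightarrow> y \<in> f ` nodes M\<close> by blast
  qed
  have 2: "closed_segment x y \<in> edges M"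
    if x: "x \<in> nodes M" and y: "y \<in> nodes M" and e: "closed_segment (f x) (f y) \<in> edges M'" for x y
  proof -
    let ?m = "midpoint (f x) (f y)"
    have m: "?m \<in> closed_segment (f x) (f y)" by simp
    then have "?m \<in> net_body M'" using e m unfolding net_body_def by blast
    then obtain p q where pq: "closed_segment p q \<in> edges M" "p \<in> nodes M" "q \<in> nodes M"
      "?m \<in> closed_segment (f p) (f q)"
      using cover by blast
    have "f x \<noteq> f y" using linear_net_edge_ends[OF M' e] by simp
    then have "?m \<notin> segment_ends (closed_segment (f x) (f y))"
      by (auto simp: midpoint_eq_endpoint)
    then have "closed_segment (f x) (f y) = closed_segment (f p) (f q)"
      using essentially_disjointD[OF ed e edge[OF pq(1)] m pq(4)] by blast
    then have "f x = f p \<and> f y = f q \<or> f x = f q \<and> f y = f p"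
      by (auto simp: closed_segment_eq doubleton_eq_iff)
    then have "x = p \<and> y = q \<or> x = q \<and> y = p"
      using inj[OF _ nb[OF x] nb[OF pq(2)]] inj[OF _ nb[OF x] nb[OF pq(3)]]
        inj[OF _ nb[OF y] nb[OF pq(2)]] inj[OF _ nb[OF y] nb[OF pq(3)]] by argo
    then show ?thesis using pq(1) by (metis closed_segment_commute)
  qed
  show ?thesis
    unfolding graph_iso_def
  proof (intro conjI ballI iffI)
    show "bij_betw f (nodes M) (nodes M')" by (rule 1)
  qed (erule edge, rule 2)
qed

lemma isotopic_graph_iso:
  assumes "periodically_isotopic M0 M1"
  obtains h where "linear_net M0" "linear_net M1" "graph_iso h M0 M1"
proof -
  obtain M :: "real \<Rightarrow> net" and f :: "real \<Rightarrow> point \<Rightarrow> point" where M: "M 0 = M0" "M 1 = M1"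
    and lin: "\<forall>t\<in>{0..1}. linear_net (M t)"
    and bij: "\<forall>t\<in>{0..1}. bij_betw (f t) (net_body M0) (net_body (M t)) \<and> f t ` nodes M0 \<subseteq> nodes (M t)"
    and edg: "\<forall>t\<in>{0..1}. \<forall>p q. closed_segment p q \<in> edges M0 \<longrightarrow>
           closed_segment (f t p) (f t q) \<in> edges (M t) \<and>
           (\<forall>u\<in>{0..1}. f t ((1 - u) *\<^sub>R p + u *\<^sub>R q) = (1 - u) *\<^sub>R f t p + u *\<^sub>R f t q)"
    using assms unfolding periodically_isotopic_def
    apply (elim exE conjE)
    subgoal for M a f by (rule that[of M f]) assumption+
    done
  have L: "linear_net M0" "linear_net M1"
    using bspec[OF lin, of 0] bspec[OF lin, of 1] M by simp_all
  have one: "(1::real) \<in> {0..1}" by simp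
  have B: "bij_betw (f 1) (net_body M0) (net_body M1)" "f 1 ` nodes M0 \<subseteq> nodes M1"
    using bspec[OF bij one] unfolding M(2) by (rule conjunct1, rule conjunct2)
  have E: "closed_segment (f 1 p) (f 1 q) \<in> edges M1 \<and>
      (\<forall>u\<in>{0..1}. f 1 ((1 - u) *\<^sub>R p + u *\<^sub>R q) = (1 - u) *\<^sub>R f 1 p + u *\<^sub>R f 1 q)"
    if "closed_segment p q \<in> edges M0" for p q
    using bspec[OF edg one, rule_format, OF that] unfolding M(2) .
  have "graph_iso (f 1) M0 M1"
    by (rule body_isomorphism_graph_iso[OF L B]) (simp_all add: E)
  with L that show thesis by blast
qed

fun graph_ball :: "net \<Rightarrow> nat \<Rightarrow> point \<Rightarrow> point set" where
  "graph_ball M 0 x = {x}"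
| "graph_ball M (Suc n) x =
     graph_ball M n x \<union> {z. \<exists>y\<in>graph_ball M n x. closed_segment y z \<in> edges M}"

definition has_triangle :: "net \<Rightarrow> bool" where
  "has_triangle M \<longleftrightarrow> (\<exists>x y z. closed_segment x y \<in> edges M \<and> closed_segment y z \<in> edges M \<and>
     closed_segment z x \<in> edges M)"

lemma graph_ball_nodes:
  assumes "linear_net M" "x \<in> nodes M" shows "graph_ball M n x \<subseteq> nodes M"
proof (induction n)
  case (Suc n)
  then show ?case using linear_net_edge_ends[OF assms(1)] by auto
qed (use assms in simp)

lemma graph_iso_ball:
  assumes M: "linear_net M" and M': "linear_net M'" and h: "graph_iso h M M'" and x: "x \<in> nodes M"
  shows "graph_ball M' n (h x) = h ` graph_ball M n x"
proof (induction n)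
  case (Suc n)
  have B: "y \<in> nodes M" if "y \<in> graph_ball M n x" for y
    using graph_ball_nodes[OF M x] that by blast
  have "{z. \<exists>y\<in>h ` graph_ball M n x. closed_segment y z \<in> edges M'}
      = h ` {z. \<exists>y\<in>graph_ball M n x. closed_segment y z \<in> edges M}" (is "?L = ?R")
  proof
    show "?L \<subseteq> ?R"
    proof
      fix z assume "z \<in> ?L"
      then obtain y where y: "y \<in> graph_ball M n x" "closed_segment (h y) z \<in> edges M'" by blast
      moreover obtain w where "w \<in> nodes M" "z = h w"
        using h linear_net_edge_ends[OF M' y(2)] unfolding graph_iso_def
        by (metis bij_betw_imp_surj_on imageE)
      ultimately show "z \<in> ?R"
        using h B[OF y(1)] by (auto simp: graph_iso_def)
    qed
    show "?R \<subseteq> ?L"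
    proof
      fix z assume "z \<in> ?R"
      then obtain y w where y: "y \<in> graph_ball M n x" "closed_segment y w \<in> edges M" "z = h w" by blast
      then have "closed_segment (h y) z \<in> edges M'"
        using h linear_net_edge_ends[OF M y(2)] by (simp add: graph_iso_def)
      then show "z \<in> ?L" using y by blast
    qed
  qed
  then show ?case using Suc by (simp add: image_Un)
qed simp

lemma graph_iso_triangle:
  assumes M: "linear_net M" and M': "linear_net M'" and h: "graph_iso h M M'"
  shows "has_triangle M' \<longleftrightarrow> has_triangle M"
proof
  assume "has_triangle M"
  then obtain x y z where e: "closed_segment x y \<in> edges M" "closed_segment y z \<in> edges M"
     "closed_segment z x \<in> edges M" unfolding has_triangle_def by blast
  have "closed_segment (h u) (h v) \<in> edges M'" if "closed_segment u v \<in> edges M" for u v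
    using h linear_net_edge_ends[OF M that] that by (simp add: graph_iso_def)
  from this[OF e(1)] this[OF e(2)] this[OF e(3)]
  show "has_triangle M'" unfolding has_triangle_def by (intro exI conjI)
next
  assume "has_triangle M'"
  then obtain x y z where e: "closed_segment x y \<in> edges M'" "closed_segment y z \<in> edges M'"
     "closed_segment z x \<in> edges M'" unfolding has_triangle_def by blast
  define g where "g = inv_into (nodes M) h"
  have "closed_segment (g u) (g v) \<in> edges M" if uv: "closed_segment u v \<in> edges M'" for u v
  proof -
    have "h ` nodes M = nodes M'" using h by (simp add: graph_iso_def bij_betw_imp_surj_on)
    then have "g u \<in> nodes M" "g v \<in> nodes M" "h (g u) = u" "h (g v) = v"
      using linear_net_edge_ends[OF M' uv]
      by (simp_all add: g_def inv_into_into f_inv_into_f)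
    then show ?thesis using h uv by (simp add: graph_iso_def)
  qed
  from this[OF e(1)] this[OF e(2)] this[OF e(3)]
  show "has_triangle M" unfolding has_triangle_def by (intro exI conjI)
qed

text \<open>The ball of radius \<open>n\<close> around 0 in the Cayley graph of the integer lattice with respect to \<open>V\<close>.\<close>
fun label_ball :: "ivec set \<Rightarrow> nat \<Rightarrow> ivec set" where
  "label_ball V 0 = {0}"
| "label_ball V (Suc n) = label_ball V n \<union> {k + m | k m. k \<in> label_ball V n \<and> m \<in> V}"

lemma graph_ball_bouquet:
  assumes a: "det a \<noteq> 0" and V: "symmetric V"
  shows "graph_ball (bouquet p a V) n (p + lat a k) = (\<lambda>m. p + lat a (k + m)) ` label_ball V n"
proof (induction n)
  case (Suc n)
  have "{z. \<exists>y\<in>(\<lambda>m. p + lat a (k + m)) ` label_ball V n. closed_segment y z \<in> edges (bouquet p a V)}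
     = (\<lambda>m. p + lat a (k + m)) ` {k + m | k m. k \<in> label_ball V n \<and> m \<in> V}" (is "?L = ?R")
  proof
    show "?L \<subseteq> ?R"
    proof
      fix z assume "z \<in> ?L"
      then obtain l where l: "l \<in> label_ball V n"
        and e: "closed_segment (p + lat a (k + l)) z \<in> edges (bouquet p a V)" by blast
      from e obtain k' m where "p + lat a (k + l) = p + lat a k'" "z = p + lat a (k' + m)" "m \<in> V"
        by (rule edge_of_bouquetE[OF _ V])
      then have "z = p + lat a (k + (l + m))" using lat_inj[OF a] by (auto simp: add.assoc)
      then show "z \<in> ?R" using l \<open>m \<in> V\<close> by blast
    qed
    show "?R \<subseteq> ?L"
    proof
      fix z assume "z \<in> ?R"
      then obtain l m where lm: "l \<in> label_ball V n" "m \<in> V" "z = p + lat a (k + (l + m))" by blast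
      then have "closed_segment (p + lat a (k + l)) z \<in> edges (bouquet p a V)"
        by (simp add: edge_in_bouquet[OF a V])
      then show "z \<in> ?L" using lm by blast
    qed
  qed
  then show ?case by (simp only: graph_ball.simps label_ball.simps Suc.IH image_Un)
qed simp

lemma card_graph_ball_bouquet:
  assumes a: "det a \<noteq> 0" and V: "symmetric V"
  shows "card (graph_ball (bouquet p a V) n (p + lat a k)) = card (label_ball V n)"
  unfolding graph_ball_bouquet[OF assms]
  by (rule card_image) (auto simp: inj_on_def lat_inj[OF a])

lemma has_triangle_bouquet:
  assumes a: "det a \<noteq> 0" and V: "symmetric V"
  shows "has_triangle (bouquet p a V) \<longleftrightarrow> (\<exists>u\<in>V. \<exists>v\<in>V. u + v \<in> V)"
proof
  assume "has_triangle (bouquet p a V)"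
  then obtain x y z where e: "closed_segment x y \<in> edges (bouquet p a V)"
     "closed_segment y z \<in> edges (bouquet p a V)" "closed_segment z x \<in> edges (bouquet p a V)"
    unfolding has_triangle_def by blast
  obtain k m where x: "x = p + lat a k" "y = p + lat a (k + m)" "m \<in> V"
    using e(1) by (rule edge_of_bouquetE[OF _ V])
  obtain k' m' where y: "y = p + lat a k'" "z = p + lat a (k' + m')" "m' \<in> V"
    using e(2) by (rule edge_of_bouquetE[OF _ V])
  have k': "k' = k + m" using x y lat_inj[OF a] by simp
  have "k - (k' + m') \<in> V" using e(3) by (simp add: x y edge_in_bouquet[OF a V])
  then have "- (k - (k' + m')) \<in> V" using V by (simp only: symmetric_def)
  then have "m + m' \<in> V" by (simp add: k' add.commute)
  then show "\<exists>u\<in>V. \<exists>v\<in>V. u + v \<in> V" using x y by blast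
next
  assume "\<exists>u\<in>V. \<exists>v\<in>V. u + v \<in> V"
  then obtain u v where uv: "u \<in> V" "v \<in> V" "- (u + v) \<in> V" using V by (auto simp: symmetric_def)
  have "closed_segment (p + lat a 0) (p + lat a u) \<in> edges (bouquet p a V)"
    "closed_segment (p + lat a u) (p + lat a (u + v)) \<in> edges (bouquet p a V)"
    "closed_segment (p + lat a (u + v)) (p + lat a 0) \<in> edges (bouquet p a V)"
    using uv by (simp_all only: edge_in_bouquet[OF a V]) simp_all
  then show "has_triangle (bouquet p a V)"
    unfolding has_triangle_def by (intro exI conjI)
qed

lemma isotopic_bouquets_invariants:
  assumes iso: "periodically_isotopic (bouquet p a V) (bouquet p' a' V')"
    and a: "det a \<noteq> 0" "det a' \<noteq> 0" and V: "symmetric V" "symmetric V'"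
  shows "card (label_ball V n) = card (label_ball V' n)"
    and "(\<exists>u\<in>V. \<exists>v\<in>V. u + v \<in> V) \<longleftrightarrow> (\<exists>u\<in>V'. \<exists>v\<in>V'. u + v \<in> V')"
proof -
  let ?M = "bouquet p a V" and ?M' = "bouquet p' a' V'"
  obtain h where M: "linear_net ?M" "linear_net ?M'" and h: "graph_iso h ?M ?M'"
    using isotopic_graph_iso[OF iso] .
  have x: "p + lat a 0 \<in> nodes ?M" unfolding nodes_bouquet by blast
  then have "h (p + lat a 0) \<in> nodes ?M'" using h by (auto simp: graph_iso_def bij_betw_def)
  then obtain k where k: "h (p + lat a 0) = p' + lat a' k" by (auto simp: nodes_bouquet)
  have "inj_on h (graph_ball ?M n (p + lat a 0))"
    using h graph_ball_nodes[OF M(1) x] by (auto simp: graph_iso_def bij_betw_def intro: inj_on_subset)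
  then have "card (graph_ball ?M' n (h (p + lat a 0))) = card (graph_ball ?M n (p + lat a 0))"
    unfolding graph_iso_ball[OF M h x] by (rule card_image)
  then show "card (label_ball V n) = card (label_ball V' n)"
    unfolding k card_graph_ball_bouquet[OF a(1) V(1)] card_graph_ball_bouquet[OF a(2) V(2)] by simp
  show "(\<exists>u\<in>V. \<exists>v\<in>V. u + v \<in> V) \<longleftrightarrow> (\<exists>u\<in>V'. \<exists>v\<in>V'. u + v \<in> V')"
    using graph_iso_triangle[OF M h] has_triangle_bouquet[OF a(1) V(1)] has_triangle_bouquet[OF a(2) V(2)]
    by simp
qed

section \<open>Admissible label sets\<close>
definition depth_one :: "ivec \<Rightarrow> bool" where
  "depth_one v = (case v of (x,y,z) \<Rightarrow> \<bar>x\<bar> \<le> 1 \<and> \<bar>y\<bar> \<le> 1 \<and> \<bar>z\<bar> \<le> 1)"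

definition even_ivec :: "ivec \<Rightarrow> bool" where
  "even_ivec v = (case v of (x,y,z) \<Rightarrow> even x \<and> even y \<and> even z)"

text \<open>Among nonzero labels with coordinates in \<open>{-1, 0, 1}\<close> this is exactly the condition that the edges of the
  bouquet do not cross.\<close>
definition noncrossing :: "ivec set \<Rightarrow> bool" where
  "noncrossing V \<longleftrightarrow> (\<forall>v\<in>V. \<forall>w\<in>V. even_ivec (v - w) \<longrightarrow> w = v \<or> w = - v)"

definition admissible :: "ivec set \<Rightarrow> bool" where
  "admissible V \<longleftrightarrow> symmetric V \<and> 0 \<notin> V \<and> (\<forall>v\<in>V. depth_one v) \<and> noncrossing V"

definition generating :: "ivec set \<Rightarrow> bool" where
  "generating V \<longleftrightarrow> (\<forall>k. \<exists>n. k \<in> label_ball V n)"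

lemma finite_depth_one: "finite {v. depth_one v}"
proof (rule finite_subset)
  show "{v. depth_one v} \<subseteq> {-1..1} \<times> {-1..1} \<times> {-1..1}"
    by (auto simp: depth_one_def abs_le_iff)
qed simp

lemma finite_admissible: "admissible V \<Longrightarrow> finite V"
  by (rule finite_subset[OF _ finite_depth_one]) (auto simp: admissible_def)

text \<open>Paths starting at \<open>p\<close> correspond to sums of labels.\<close>
lemma connected_bouquet:
  assumes a: "det a \<noteq> 0" and V: "symmetric V"
  shows "connected_net (bouquet p a V) \<longleftrightarrow> generating V"
proof -
  let ?R = "{(x, y). closed_segment x y \<in> edges (bouquet p a V)}"
  have path: "(p + lat a k, p + lat a (k + m)) \<in> ?R\<^sup>*" if "m \<in> label_ball V n" for k m n
    using that
  proof (induction n arbitrary: m)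
    case (Suc n)
    then consider "m \<in> label_ball V n" | l v where "m = l + v" "l \<in> label_ball V n" "v \<in> V" by auto
    then show ?case
    proof cases
      case 1 then show ?thesis by (rule Suc.IH)
    next
      case 2
      then have "(p + lat a (k + l), p + lat a (k + m)) \<in> ?R"
        by (simp add: edge_in_bouquet[OF a V] add.assoc[symmetric])
      with Suc.IH[OF 2(2)] show ?thesis by (rule rtrancl_into_rtrancl)
    qed
  qed simp
  have reach: "\<exists>m n. m \<in> label_ball V n \<and> y = p + lat a m" if "(p + lat a 0, y) \<in> ?R\<^sup>*" for y
    using that
  proof (induction rule: rtrancl_induct)
    case base
    then show ?case by (intro exI[of _ 0] exI[of _ 0]) simp
  next
    case (step y z)
    then obtain m n where m: "m \<in> label_ball V n" "y = p + lat a m" by blast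
    from step(2) have "closed_segment y z \<in> edges (bouquet p a V)" by simp
    then obtain k v where k: "y = p + lat a k" "z = p + lat a (k + v)" "v \<in> V"
      by (rule edge_of_bouquetE[OF _ V])
    then have "k = m" using m(2) lat_inj[OF a] by simp
    then have "k + v \<in> label_ball V (Suc n)" using m k by auto
    with k show ?case by blast
  qed
  show ?thesis
  proof
    assume c: "connected_net (bouquet p a V)"
    show "generating V"
      unfolding generating_def
    proof
      fix k
      have "(p + lat a 0, p + lat a k) \<in> ?R\<^sup>*"
        using c unfolding connected_net_def nodes_bouquet by blast
      then obtain m n where "m \<in> label_ball V n" "p + lat a k = p + lat a m"
        using reach by blast
      then show "\<exists>n. k \<in> label_ball V n" using lat_inj[OF a] by auto
    qed
  next
    assume g: "generating V"
    have "(p + lat a k, p + lat a l) \<in> ?R\<^sup>*" for k l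
    proof -
      obtain n where "l - k \<in> label_ball V n" using g unfolding generating_def by blast
      from path[OF this, of k] show ?thesis by simp
    qed
    then show "connected_net (bouquet p a V)"
      unfolding connected_net_def nodes_bouquet by blast
  qed
qed

lemma segment_midpoint:
  "p + (1/2) *\<^sub>R (x + y) \<in> closed_segment (p + x) (p + y)" for p :: point
  unfolding in_segment
  by (rule exI[of _ "1/2"]) (simp add: vec_eq_iff field_simps)

text \<open>If \<open>v = w + 2 d\<close>, then the edge from \<open>0\<close> to \<open>v\<close> and the edge from \<open>d\<close> to \<open>d + w\<close> have the same midpoint.\<close>
lemma noncrossing_if_disjoint:
  assumes a: "det a \<noteq> 0" and V: "symmetric V" "0 \<notin> V"
    and disj: "essentially_disjoint (edges (bouquet p a V))"
  shows "noncrossing V"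
  unfolding noncrossing_def
proof (intro ballI impI)
  fix v w assume v: "v \<in> V" and w: "w \<in> V" and even: "even_ivec (v - w)"
  obtain d where d: "v - w = d + d"
  proof -
    obtain x y z where xyz: "v - w = (x, y, z)" by (cases "v - w")
    with even have "even x" "even y" "even z" by (simp_all add: even_ivec_def)
    then have "v - w = (x div 2, y div 2, z div 2) + (x div 2, y div 2, z div 2)"
      unfolding xyz by simp
    then show thesis by (rule that)
  qed
  let ?z = "p + (1/2) *\<^sub>R lat a v"
  let ?e = "closed_segment (p + lat a 0) (p + lat a v)"
  let ?e' = "closed_segment (p + lat a d) (p + lat a (d + w))"
  have e: "?e \<in> edges (bouquet p a V)" "?e' \<in> edges (bouquet p a V)"
    using v w by (simp_all only: edge_in_bouquet[OF a V(1)]) simp_all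
  have z: "?z \<in> ?e" using segment_midpoint[of p "lat a 0" "lat a v"] by simp
  have "v = d + (d + w)" using d by (simp add: algebra_simps)
  then have "lat a v = lat a d + lat a (d + w)" by (metis lat_add)
  then have z': "?z \<in> ?e'" using segment_midpoint[of p "lat a d" "lat a (d + w)"] by simp
  have "lat a v \<noteq> 0" using v V(2) lat_eq_0_iff[OF a] by metis
  then have "(1/2) *\<^sub>R lat a v \<noteq> 0" "(1/2) *\<^sub>R lat a v \<noteq> lat a v"
    using scaleR_cancel_right[of "1/2" "lat a v" 1] by simp_all
  then have "?z \<notin> segment_ends ?e" by simp
  then have "?e = ?e'" using essentially_disjointD[OF disj e z z'] by blast
  then have "0 = d \<and> v = d + w \<or> 0 = d + w \<and> v = d"
    unfolding closed_segment_eq doubleton_eq_iff by (simp add: lat_inj[OF a] lat_eq_0_iff[OF a])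
  then show "w = v \<or> w = - v"
  proof (elim disjE conjE)
    assume "0 = d" "v = d + w" then show ?thesis by simp
  next
    assume "0 = d + w" "v = d"
    then have "w = - v" by (simp add: eq_neg_iff_add_eq_0 add.commute)
    then show ?thesis ..
  qed
qed

text \<open>Two segments with two common points, both of them endpoints of both segments, coincide; so
  uniqueness of the common point comes for free.\<close>
lemma essentially_disjointI:
  assumes seg: "\<And>e. e \<in> S \<Longrightarrow> \<exists>p q. e = closed_segment p q"
    and ends: "\<And>e e' z. e \<in> S \<Longrightarrow> e' \<in> S \<Longrightarrow> e \<noteq> e' \<Longrightarrow> z \<in> e \<Longrightarrow> z \<in> e' \<Longrightarrow>
      z \<in> segment_ends e \<and> z \<in> segment_ends e'"
  shows "essentially_disjoint S"
  unfolding essentially_disjoint_def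
proof (intro ballI impI)
  fix e e' assume e: "e \<in> S" "e' \<in> S" "e \<noteq> e'"
  show "e \<inter> e' = {} \<or> (\<exists>x. e \<inter> e' = {x} \<and> x \<in> segment_ends e \<and> x \<in> segment_ends e')"
  proof (rule disjCI)
    assume none: "\<not> (\<exists>x. e \<inter> e' = {x} \<and> x \<in> segment_ends e \<and> x \<in> segment_ends e')"
    show "e \<inter> e' = {}"
    proof (rule ccontr)
      assume "e \<inter> e' \<noteq> {}"
      then obtain x where "x \<in> e \<inter> e'" by (metis ex_in_conv)
      then have x: "x \<in> e" "x \<in> e'" by simp_all
      have "\<exists>y. y \<in> e \<inter> e' \<and> x \<noteq> y"
      proof (rule ccontr)
        assume no: "\<nexists>y. y \<in> e \<inter> e' \<and> x \<noteq> y"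
        have "z = x" if "z \<in> e \<inter> e'" for z using no that by metis
        moreover have "x \<in> e \<inter> e'" using x by simp
        ultimately have "e \<inter> e' = {x}" by blast
        with ends[OF e x] have "\<exists>x. e \<inter> e' = {x} \<and> x \<in> segment_ends e \<and> x \<in> segment_ends e'"
          by (intro exI[of _ x] conjI) simp_all
        then show False using none by (rule notE[rotated])
      qed
      then obtain y where y: "y \<in> e" "y \<in> e'" "x \<noteq> y" by (metis IntE)
      obtain p q p' q' where pq: "e = closed_segment p q" "e' = closed_segment p' q'"
        using seg e by metis
      have "x \<in> {p, q}" "y \<in> {p, q}" "x \<in> {p', q'}" "y \<in> {p', q'}"
        using ends[OF e x] ends[OF e y(1,2)] unfolding pq segment_ends_closed_segment by simp_all
      then have "{p, q} = {x, y}" "{p', q'} = {x, y}" using y(3) by auto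
      then have "{p, q} = {p', q'}" by simp
      then show False using e(3) unfolding pq closed_segment_eq by blast
    qed
  qed
qed

lemma lat_line_meet:
  assumes a: "det a \<noteq> 0"
    and eq: "lat a (k1,k2,k3) + s *\<^sub>R lat a (m1,m2,m3) = lat a (l1,l2,l3) + t *\<^sub>R lat a (n1,n2,n3)"
  shows "of_int k1 + s * of_int m1 = of_int l1 + t * of_int n1 \<and>
         of_int k2 + s * of_int m2 = of_int l2 + t * of_int n2 \<and>
         of_int k3 + s * of_int m3 = of_int l3 + t * of_int n3"
proof -
  have "(of_int k1 + s * of_int m1 - of_int l1 - t * of_int n1) *\<^sub>R a $ 1
     + (of_int k2 + s * of_int m2 - of_int l2 - t * of_int n2) *\<^sub>R a $ 2
     + (of_int k3 + s * of_int m3 - of_int l3 - t * of_int n3) *\<^sub>R a $ 3 = 0"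
    using eq by (simp add: lat_def algebra_simps)
  from coordinates_unique[OF a this] show ?thesis by simp
qed

text \<open>Modulo 2 the two vectors are distinct and nonzero, hence linearly independent, so some minor is odd;
  and minors of vectors with entries in \<open>{-1, 0, 1}\<close> have absolute value at most 2.\<close>
lemma odd_minor:
  assumes "depth_one (x,y,z)" "depth_one (x',y',z')"
    and "\<not> even_ivec (x,y,z)" "\<not> even_ivec (x',y',z')" "\<not> even_ivec (x - x', y - y', z - z')"
  shows "\<bar>x * y' - y * x'\<bar> = 1 \<or> \<bar>y * z' - z * y'\<bar> = 1 \<or> \<bar>z * x' - x * z'\<bar> = 1"
proof -
  have *: "w \<in> {-1, 0, 1}" if "\<bar>w\<bar> \<le> 1" for w :: int using that by auto
  have cube: "x \<in> {-1,0,1}" "y \<in> {-1,0,1}" "z \<in> {-1,0,1}" "x' \<in> {-1,0,1}" "y' \<in> {-1,0,1}" "z' \<in> {-1,0,1}"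
    using assms(1,2) * by (simp_all add: depth_one_def)
  have "odd (x * y' - y * x') \<or> odd (y * z' - z * y') \<or> odd (z * x' - x * z')"
    using assms(3-) by (auto simp: even_ivec_def)
  moreover have "\<bar>a * d - b * c\<bar> = 1"
    if "odd (a * d - b * c)" "a \<in> {-1,0,1}" "b \<in> {-1,0,1}" "c \<in> {-1,0,1}" "d \<in> {-1,0,1}" for a b c d :: int
    using that by auto
  ultimately show ?thesis using cube by metis
qed

lemma unit_interval_integer:
  assumes "0 \<le> s" "s \<le> 1" "s = of_int n" shows "s = 0 \<or> s = (1::real)"
proof -
  have "n = 0 \<or> n = 1" using assms by auto
  then show ?thesis using assms by auto
qed

text \<open>Cramer's rule for the two equations in the unknowns \<open>s\<close> and \<open>t\<close>.\<close>
lemma minor_integer: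
  assumes "of_int k + s * of_int m = of_int l + t * (of_int n :: real)"
    and "of_int k' + s * of_int m' = of_int l' + t * (of_int n' :: real)"
    and "\<bar>m * n' - m' * n\<bar> = 1"
  shows "(\<exists>i. s = of_int i) \<and> (\<exists>j. t = of_int j)"
proof -
  define D where "D = m * n' - m' * n"
  have D: "of_int D * of_int D = (1::real)"
    using assms(3) unfolding D_def[symmetric] by (simp add: abs_if flip: of_int_mult split: if_splits)
  have "s * of_int D = of_int ((l - k) * n' - (l' - k') * n)"
    using assms(1,2) unfolding D_def of_int_diff of_int_mult by algebra
  then have "s * (of_int D * of_int D) = of_int (((l - k) * n' - (l' - k') * n) * D)"
    by (simp only: mult.assoc[symmetric] of_int_mult)
  moreover have "t * of_int D = of_int ((l - k) * m' - (l' - k') * m)"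
    using assms(1,2) unfolding D_def of_int_diff of_int_mult by algebra
  then have "t * (of_int D * of_int D) = of_int (((l - k) * m' - (l' - k') * m) * D)"
    by (simp only: mult.assoc[symmetric] of_int_mult)
  ultimately show ?thesis unfolding D by (metis mult.right_neutral)
qed

lemma transversal_meet:
  assumes a: "det a \<noteq> 0" and st: "0 \<le> s" "s \<le> 1" "0 \<le> t" "t \<le> 1"
    and eq: "lat a k + s *\<^sub>R lat a m = lat a l + t *\<^sub>R lat a n"
    and m: "depth_one m" "\<not> even_ivec m" and n: "depth_one n" "\<not> even_ivec n"
    and mn: "\<not> even_ivec (m - n)"
  shows "(s = 0 \<or> s = 1) \<and> (t = 0 \<or> t = 1)"
proof -
  obtain k1 k2 k3 where [simp]: "k = (k1,k2,k3)" by (cases k)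
  obtain m1 m2 m3 where [simp]: "m = (m1,m2,m3)" by (cases m)
  obtain l1 l2 l3 where [simp]: "l = (l1,l2,l3)" by (cases l)
  obtain n1 n2 n3 where [simp]: "n = (n1,n2,n3)" by (cases n)
  have E1: "of_int k1 + s * of_int m1 = of_int l1 + t * of_int n1"
    and E2: "of_int k2 + s * of_int m2 = of_int l2 + t * of_int n2"
    and E3: "of_int k3 + s * of_int m3 = of_int l3 + t * of_int n3"
    using lat_line_meet[OF a, of k1 k2 k3 s m1 m2 m3 l1 l2 l3 t n1 n2 n3] eq by simp_all
  have "\<bar>m1 * n2 - m2 * n1\<bar> = 1 \<or> \<bar>m2 * n3 - m3 * n2\<bar> = 1 \<or> \<bar>m3 * n1 - m1 * n3\<bar> = 1"
    using m n mn by (intro odd_minor) simp_all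
  then have "(\<exists>i. s = of_int i) \<and> (\<exists>j. t = of_int j)"
    using minor_integer[OF E1 E2] minor_integer[OF E2 E3] minor_integer[OF E3 E1] by blast
  then show ?thesis using st unit_interval_integer by blast
qed

text \<open>Here \<open>t - s\<close> is an integer, as some coordinate of \<open>m\<close> is \<open>1\<close> or \<open>-1\<close>.\<close>
lemma parallel_meet:
  assumes a: "det a \<noteq> 0" and st: "0 \<le> s" "s \<le> 1" "0 \<le> t" "t \<le> 1"
    and eq: "lat a k + s *\<^sub>R lat a m = lat a l + t *\<^sub>R lat a m"
    and m: "depth_one m" "m \<noteq> 0"
  shows "k = l \<or> ((s = 0 \<or> s = 1) \<and> (t = 0 \<or> t = 1))"
proof -
  obtain k1 k2 k3 where [simp]: "k = (k1,k2,k3)" by (cases k)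
  obtain m1 m2 m3 where [simp]: "m = (m1,m2,m3)" by (cases m)
  obtain l1 l2 l3 where [simp]: "l = (l1,l2,l3)" by (cases l)
  have E1: "of_int k1 + s * of_int m1 = of_int l1 + t * of_int m1"
    and E2: "of_int k2 + s * of_int m2 = of_int l2 + t * of_int m2"
    and E3: "of_int k3 + s * of_int m3 = of_int l3 + t * of_int m3"
    using lat_line_meet[OF a, of k1 k2 k3 s m1 m2 m3 l1 l2 l3 t m1 m2 m3] eq by simp_all
  have unit: "\<exists>j. t - s = of_int j" if "of_int i + s * of_int c = of_int i' + t * (of_int c :: real)"
     "\<bar>c\<bar> = 1" for c i i' :: int
  proof -
    have "(t - s) * of_int c = of_int (i - i')" using that(1) by (simp add: algebra_simps)
    then have "(t - s) * (of_int c * of_int c) = of_int ((i - i') * c)" by simp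
    moreover have "of_int c * of_int c = (1::real)"
      using that(2) by (simp add: abs_if flip: of_int_mult split: if_splits)
    ultimately show ?thesis by (metis mult.right_neutral)
  qed
  have "\<bar>m1\<bar> = 1 \<or> \<bar>m2\<bar> = 1 \<or> \<bar>m3\<bar> = 1"
    using m by (auto simp: depth_one_def zero_prod_def)
  then obtain j where j: "t - s = of_int j" using unit[OF E1] unit[OF E2] unit[OF E3] by blast
  have "-1 \<le> j \<and> j \<le> 1"
  proof -
    have "of_int j \<le> (1::real)" "(-1::real) \<le> of_int j" using st by (simp_all flip: j)
    then show ?thesis by simp
  qed
  then consider "j = 0" | "j = 1" | "j = -1" by linarith
  then show ?thesis
  proof cases
    case 1
    then have "t = s" using j by simp
    then show ?thesis using E1 E2 E3 by simp
  next
    case 2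
    then have "t = 1 \<and> s = 0" using j st by simp
    then show ?thesis by simp
  next
    case 3
    then have "s = 1 \<and> t = 0" using j st by simp
    then show ?thesis by simp
  qed
qed

lemma disjoint_if_admissible:
  assumes a: "det a \<noteq> 0" and V: "admissible V"
  shows "essentially_disjoint (edges (bouquet p a V))"
proof (rule essentially_disjointI)
  show "\<exists>x y. e = closed_segment x y" if "e \<in> edges (bouquet p a V)" for e
    using that unfolding edges_bouquet by blast
  fix e e' z assume e: "e \<in> edges (bouquet p a V)" "e' \<in> edges (bouquet p a V)" "e \<noteq> e'"
    and z: "z \<in> e" "z \<in> e'"
  have odd: "\<not> even_ivec v" if "v \<in> V" for v
  proof
    assume "even_ivec v"
    moreover have "depth_one v" using V that by (simp add: admissible_def)
    moreover have "x = 0" if "even x" "\<bar>x\<bar> \<le> 1" for x :: int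
      using that by presburger
    ultimately have "v = 0"
      by (cases v) (simp add: even_ivec_def depth_one_def zero_prod_def)
    then show False using V that by (simp add: admissible_def)
  qed
  have param: "\<exists>s. 0 \<le> s \<and> s \<le> 1 \<and> x = p + (lat a k + s *\<^sub>R lat a v)"
    if "x \<in> closed_segment (p + lat a k) (p + lat a (k + v))" for x k v
  proof -
    obtain s where s: "0 \<le> s" "s \<le> 1" "x = (1 - s) *\<^sub>R (p + lat a k) + s *\<^sub>R (p + lat a (k + v))"
      using \<open>x \<in> _\<close> unfolding in_segment by blast
    have "x = p + (lat a k + s *\<^sub>R lat a v)"
      unfolding s(3) by (simp add: lat_add algebra_simps flip: scaleR_add_left)
    with s show ?thesis by blast
  qed
  have endp: "p + (lat a k + s *\<^sub>R lat a v) \<in> segment_ends (closed_segment (p + lat a k) (p + lat a (k + v)))"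
    if "s = 0 \<or> s = 1" for s k v
    using that by (auto simp: lat_add)
  obtain k v where kv: "e = closed_segment (p + lat a k) (p + lat a (k + v))" "v \<in> V"
    using e(1) unfolding edges_bouquet by blast
  \<comment> \<open>an edge with label \<open>- v\<close> is read backwards, so that parallel edges have equal labels\<close>
  obtain l w where lw: "e' = closed_segment (p + lat a l) (p + lat a (l + w))" "w \<in> V" "w \<noteq> - v"
  proof -
    obtain l w where lw: "e' = closed_segment (p + lat a l) (p + lat a (l + w))" "w \<in> V"
      using e(2) unfolding edges_bouquet by blast
    show thesis
    proof (cases "w = - v")
      case True
      have "e' = closed_segment (p + lat a (l + w)) (p + lat a ((l + w) + v))"
        unfolding lw(1) True by (simp add: closed_segment_commute)
      moreover have "v \<noteq> - v"
      proof
        assume "v = - v"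
        then have "v = 0" by (cases v) (simp add: zero_prod_def)
        then show False using kv(2) V by (simp add: admissible_def)
      qed
      ultimately show thesis using that kv(2) by blast
    next
      case False
      then show thesis using that lw by blast
    qed
  qed
  obtain s where s: "0 \<le> s" "s \<le> 1" "z = p + (lat a k + s *\<^sub>R lat a v)"
    using param z(1) unfolding kv by blast
  obtain t where t: "0 \<le> t" "t \<le> 1" "z = p + (lat a l + t *\<^sub>R lat a w)"
    using param z(2) unfolding lw by blast
  have eq: "lat a k + s *\<^sub>R lat a v = lat a l + t *\<^sub>R lat a w" using s(3) t(3) by simp
  have dv: "depth_one v" "v \<noteq> 0" and dw: "depth_one w"
    using V kv(2) lw(2) by (auto simp: admissible_def)
  have "(s = 0 \<or> s = 1) \<and> (t = 0 \<or> t = 1)"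
  proof (cases "w = v")
    case True
    have "k \<noteq> l" using e(3) unfolding kv lw True by blast
    then show ?thesis
      using parallel_meet[OF a s(1,2) t(1,2) eq[unfolded True] dv] by blast
  next
    case False
    then have "\<not> even_ivec (v - w)"
      using V kv(2) lw(2,3) unfolding admissible_def noncrossing_def by blast
    then show ?thesis
      using transversal_meet[OF a s(1,2) t(1,2) eq dv(1) odd[OF kv(2)] dw odd[OF lw(2)]] by blast
  qed
  then show "z \<in> segment_ends e \<and> z \<in> segment_ends e'"
    using endp[of s k v] endp[of t l w] unfolding kv(1) lw(1) s(3)[symmetric] t(3)[symmetric] by simp
qed

section \<open>Nets with a single node orbit\<close>
definition target_nets :: "net set" where
  "target_nets = {M. linear_net M \<and> connected_net M \<and> adjacency_depth M = 1 \<and>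
                  (\<exists>G. quotient_graph_of M G \<and> card (gverts G) = 1)}"

lemma node_orbit_bouquet:
  assumes "x \<in> nodes (bouquet p a V)"
  shows "node_orbit a x = nodes (bouquet p a V)"
proof -
  obtain j where j: "x = p + lat a j" using assms unfolding nodes_bouquet by blast
  show ?thesis
    unfolding node_orbit_lat nodes_bouquet j
  proof (intro equalityI subsetI)
    fix y assume "y \<in> range (\<lambda>k. p + lat a j + lat a k)"
    then obtain k where "y = p + lat a (j + k)" by (auto simp: lat_add add.assoc)
    then show "y \<in> range (\<lambda>k. p + lat a k)" by blast
  next
    fix y assume "y \<in> range (\<lambda>k. p + lat a k)"
    then obtain k where "y = p + lat a k" by blast
    then have "y = p + lat a j + lat a (k - j)" by (simp add: lat_diff)
    then show "y \<in> range (\<lambda>k. p + lat a j + lat a k)" by blast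
  qed
qed

lemma node_orbits_bouquet: "node_orbit a ` nodes (bouquet p a V) = {nodes (bouquet p a V)}"
proof -
  have "p + lat a 0 \<in> nodes (bouquet p a V)" unfolding nodes_bouquet by blast
  then show ?thesis using node_orbit_bouquet[of _ p a V] by blast
qed

lemma edge_orbit_bouquet:
  "edge_orbit a (closed_segment (p + lat a k) (p + lat a (k + m)))
     = range (\<lambda>l. closed_segment (p + lat a l) (p + lat a (l + m)))"
  unfolding edge_orbit_lat translate_segment
proof (intro equalityI subsetI)
  fix e assume "e \<in> range (\<lambda>l. closed_segment (p + lat a k + lat a l) (p + lat a (k + m) + lat a l))"
  then obtain l where "e = closed_segment (p + lat a (k + l)) (p + lat a ((k + l) + m))"
    by (auto simp: lat_add add_ac)
  then show "e \<in> range (\<lambda>l. closed_segment (p + lat a l) (p + lat a (l + m)))" by blast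
next
  fix e assume "e \<in> range (\<lambda>l. closed_segment (p + lat a l) (p + lat a (l + m)))"
  then obtain l where "e = closed_segment (p + lat a l) (p + lat a (l + m))" by blast
  then have "e = closed_segment (p + lat a k + lat a (l - k)) (p + lat a (k + m) + lat a (l - k))"
    by (simp add: lat_diff lat_add add_ac)
  then show "e \<in> range (\<lambda>l. closed_segment (p + lat a k + lat a l) (p + lat a (k + m) + lat a l))" by blast
qed

lemma periodicity_basis_bouquet:
  assumes a: "det a \<noteq> 0" and fin: "finite V"
  shows "periodicity_basis (bouquet p a V) a"
  unfolding periodicity_basis_lat
proof (intro conjI allI)
  let ?M = "bouquet p a V"
  have sub: "(\<lambda>x. x + lat a k) ` nodes ?M \<subseteq> nodes ?M" for k
    unfolding nodes_bouquet by (auto simp: add.assoc simp flip: lat_add)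
  have sube: "(\<lambda>x. x + lat a k) ` e \<in> edges ?M" if e: "e \<in> edges ?M" for k e
  proof -
    obtain l m where lm: "e = closed_segment (p + lat a l) (p + lat a (l + m))" "m \<in> V"
      using e unfolding edges_bouquet by blast
    have "(\<lambda>x. x + lat a k) ` e = closed_segment (p + lat a (l + k)) (p + lat a ((l + k) + m))"
      unfolding lm(1) translate_segment by (simp add: lat_add add_ac)
    then show ?thesis unfolding edges_bouquet using lm(2) by blast
  qed
  fix k
  show "(\<lambda>x. x + lat a k) ` nodes ?M = nodes ?M"
  proof
    show "nodes ?M \<subseteq> (\<lambda>x. x + lat a k) ` nodes ?M"
    proof
      fix x assume "x \<in> nodes ?M"
      then have "x + lat a (- k) \<in> nodes ?M" using sub[of "- k"] by blast
      moreover have "x = (x + lat a (- k)) + lat a k" by (simp add: lat_minus)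
      ultimately show "x \<in> (\<lambda>x. x + lat a k) ` nodes ?M" by blast
    qed
  qed (rule sub)
  show "(\<lambda>e. (\<lambda>x. x + lat a k) ` e) ` edges ?M = edges ?M"
  proof
    show "edges ?M \<subseteq> (\<lambda>e. (\<lambda>x. x + lat a k) ` e) ` edges ?M"
    proof
      fix e assume "e \<in> edges ?M"
      then have "(\<lambda>x. x + lat a (- k)) ` e \<in> edges ?M" by (rule sube)
      moreover have "e = (\<lambda>x. x + lat a k) ` (\<lambda>x. x + lat a (- k)) ` e"
        by (simp add: image_image lat_minus)
      ultimately show "e \<in> (\<lambda>e. (\<lambda>x. x + lat a k) ` e) ` edges ?M" by blast
    qed
  qed (use sube in blast)
  show "finite (node_orbit a ` nodes ?M)" by (simp add: node_orbits_bouquet)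
  have "edge_orbit a ` edges ?M \<subseteq> (\<lambda>m. range (\<lambda>l. closed_segment (p + lat a l) (p + lat a (l + m)))) ` V"
    unfolding edges_bouquet using edge_orbit_bouquet by blast
  then show "finite (edge_orbit a ` edges ?M)" using fin by (rule finite_subset[OF _ finite_imageI])
qed (rule a)

lemma linear_net_bouquet:
  assumes a: "det a \<noteq> 0" and V: "admissible V" "V \<noteq> {}"
  shows "linear_net (bouquet p a V)"
  unfolding linear_net_def
proof (intro conjI ballI)
  let ?M = "bouquet p a V"
  have "edges ?M = (\<lambda>(k, m). closed_segment (p + lat a k) (p + lat a (k + m))) ` (UNIV \<times> V)"
    unfolding edges_bouquet by auto
  then show "countable (edges ?M)" by simp
  show "is_segment e" if e: "e \<in> edges ?M" for e
  proof -
    obtain k m where km: "e = closed_segment (p + lat a k) (p + lat a (k + m))" "m \<in> V"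
      using e unfolding edges_bouquet by blast
    have "lat a k \<noteq> lat a (k + m)"
      using km(2) V(1) lat_inj[OF a, of k "k + m"] by (auto simp: admissible_def)
    then show ?thesis unfolding is_segment_def km(1) by (metis add_left_cancel)
  qed
  show "essentially_disjoint (edges ?M)" by (rule disjoint_if_admissible[OF a V(1)])
  show "nodes ?M = (\<Union>e\<in>edges ?M. segment_ends e)"
  proof (intro equalityI subsetI)
    fix x assume "x \<in> nodes ?M"
    then obtain k where k: "x = p + lat a k" unfolding nodes_bouquet by blast
    obtain m where "m \<in> V" using V(2) by blast
    then have "closed_segment (p + lat a k) (p + lat a (k + m)) \<in> edges ?M"
      unfolding edges_bouquet by blast
    moreover have "x \<in> segment_ends (closed_segment (p + lat a k) (p + lat a (k + m)))"
      using k by simp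
    ultimately show "x \<in> (\<Union>e\<in>edges ?M. segment_ends e)" by blast
  next
    fix x assume "x \<in> (\<Union>e\<in>edges ?M. segment_ends e)"
    then obtain k m where "x \<in> segment_ends (closed_segment (p + lat a k) (p + lat a (k + m)))"
      unfolding edges_bouquet by blast
    then show "x \<in> nodes ?M" unfolding segment_ends_closed_segment nodes_bouquet by blast
  qed
  show "\<exists>a. periodicity_basis ?M a"
    using periodicity_basis_bouquet[OF a finite_admissible[OF V(1)]] by blast
qed

text \<open>A translation that preserves the node set maps \<open>p\<close> to a node, so it is by a vector of the lattice.\<close>
lemma translation_subgroup_of_orbit:
  assumes nodes: "nodes M = node_orbit a p" and b: "periodicity_basis M b"
  shows "translation_group b \<subseteq> translation_group a"
proof
  fix g assume "g \<in> translation_group b"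
  then obtain k where g: "g = (\<lambda>x. x + lat b k)" unfolding translation_group_lat by blast
  have "p + lat a 0 \<in> nodes M" unfolding nodes node_orbit_lat by blast
  moreover have "(\<lambda>x. x + lat b k) ` nodes M = nodes M"
    using b unfolding periodicity_basis_lat by blast
  ultimately have "p + lat a 0 + lat b k \<in> nodes M" by blast
  then obtain l where "p + lat a 0 + lat b k = p + lat a l"
    unfolding nodes node_orbit_lat by blast
  then have "lat b k = lat a l" by simp
  then show "g \<in> translation_group a" unfolding g translation_group_lat by auto
qed

lemma primitive_basis_single_orbit:
  assumes a: "periodicity_basis M a" and nodes: "nodes M = node_orbit a p"
  shows "primitive_basis M a"
    and "primitive_basis M b \<Longrightarrow> translation_group b = translation_group a"
  using translation_subgroup_of_orbit[OF nodes] a unfolding primitive_basis_def by blast+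

text \<open>The label set is finite because an orbit of edges determines its label up to sign.\<close>
lemma single_orbit_bouquet:
  assumes M: "linear_net M" and a: "periodicity_basis M a" and nodes: "nodes M = node_orbit a p"
  obtains V where "M = bouquet p a V" "symmetric V" "0 \<notin> V" "finite V"
proof -
  define V where "V = {m. closed_segment p (p + lat a m) \<in> edges M}"
  have det: "det a \<noteq> 0" using a by (simp add: periodicity_basis_lat)
  have shift: "closed_segment (x + lat a k) (y + lat a k) \<in> edges M"
    if "closed_segment x y \<in> edges M" for x y k
  proof -
    have "(\<lambda>e. (\<lambda>x. x + lat a k) ` e) ` edges M = edges M"
      using a unfolding periodicity_basis_lat by blast
    then have "(\<lambda>x. x + lat a k) ` closed_segment x y \<in> edges M" using that by blast
    then show ?thesis unfolding translate_segment .
  qed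
  have V: "closed_segment (p + lat a k) (p + lat a (k + m)) \<in> edges M \<longleftrightarrow> m \<in> V" for k m
  proof
    assume "closed_segment (p + lat a k) (p + lat a (k + m)) \<in> edges M"
    from shift[OF this, of "- k"] show "m \<in> V" by (simp add: V_def lat_add lat_minus)
  next
    assume "m \<in> V"
    then have "closed_segment p (p + lat a m) \<in> edges M" by (simp add: V_def)
    from shift[OF this, of k]
    show "closed_segment (p + lat a k) (p + lat a (k + m)) \<in> edges M"
      by (simp add: lat_add add_ac)
  qed
  have "edges M = edges (bouquet p a V)"
  proof (intro equalityI subsetI)
    fix e assume e: "e \<in> edges M"
    obtain x y where xy: "e = closed_segment x y" "x \<in> nodes M" "y \<in> nodes M"
      by (rule linear_net_edgeE[OF M e])
    then obtain k l where kl: "x = p + lat a k" "y = p + lat a l"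
      unfolding nodes node_orbit_lat by blast
    have "e = closed_segment (p + lat a k) (p + lat a (k + (l - k)))" by (simp add: xy(1) kl)
    then show "e \<in> edges (bouquet p a V)" unfolding edges_bouquet using V e by blast
  next
    fix e assume "e \<in> edges (bouquet p a V)"
    then show "e \<in> edges M" unfolding edges_bouquet using V by blast
  qed
  moreover have "nodes M = nodes (bouquet p a V)"
    unfolding nodes node_orbit_lat nodes_bouquet ..
  ultimately have eq: "M = bouquet p a V" by (simp add: prod_eq_iff)
  have sym: "symmetric V"
    unfolding symmetric_def
  proof
    fix m assume "m \<in> V"
    then have "closed_segment (p + lat a 0) (p + lat a (0 + m)) \<in> edges M" by (simp only: V)
    then have "closed_segment (p + lat a m) (p + lat a (m + - m)) \<in> edges M"
      by (simp add: closed_segment_commute)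
    then show "- m \<in> V" by (simp only: V)
  qed
  have zero: "0 \<notin> V"
    using linear_net_edge_ends[OF M, of p p] V[of 0 0] by auto
  have "finite V"
  proof -
    define F where "F m = edge_orbit a (closed_segment p (p + lat a m))" for m
    have F: "F m = range (\<lambda>l. closed_segment (p + lat a l) (p + lat a (l + m)))" for m
      using edge_orbit_bouquet[of a p 0 m] by (simp add: F_def)
    have "F ` V \<subseteq> edge_orbit a ` edges M" unfolding F_def V_def by blast
    then have fin: "finite (F ` V)"
      using a unfolding periodicity_basis_lat by (meson finite_subset)
    have fib: "m' = m \<or> m' = - m" if FF: "F m' = F m" for m m'
    proof -
      have "closed_segment (p + lat a 0) (p + lat a (0 + m')) \<in> F m'"
        unfolding F by (rule range_eqI[of _ _ 0]) simp
      then obtain l where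
        "closed_segment (p + lat a 0) (p + lat a (0 + m')) = closed_segment (p + lat a l) (p + lat a (l + m))"
        unfolding FF unfolding F by blast
      then have "0 = l \<and> m' = l + m \<or> 0 = l + m \<and> m' = l"
        unfolding closed_segment_eq doubleton_eq_iff
        using lat_inj[OF det, of 0] lat_inj[OF det] by simp
      then show ?thesis by (auto simp: eq_neg_iff_add_eq_0)
    qed
    have "finite {m \<in> V. F m = y}" for y
    proof (cases "\<exists>m0\<in>V. F m0 = y")
      case True
      then obtain m0 where "F m0 = y" by blast
      then have "{m \<in> V. F m = y} \<subseteq> {m0, - m0}" using fib by blast
      then show ?thesis by (rule finite_subset) simp
    next
      case False
      then have "{m \<in> V. F m = y} = {}" by blast
      then show ?thesis by (metis finite.emptyI)
    qed
    then have "finite (\<Union>y\<in>F ` V. {m \<in> V. F m = y})" using fin by blast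
    moreover have "V \<subseteq> (\<Union>y\<in>F ` V. {m \<in> V. F m = y})" by blast
    ultimately show ?thesis by (rule rev_finite_subset)
  qed
  with eq sym zero that show thesis by blast
qed

text \<open>The numbers whose maximum is the depth of the labelled quotient graph.\<close>
definition label_sizes :: "ivec set \<Rightarrow> nat set" where
  "label_sizes V = {nat \<bar>m $ i\<bar> | m i. ivec_of m \<in> V}"

lemma depth_LQG_bouquet:
  assumes a: "det a \<noteq> 0" and V: "symmetric V" and r: "representatives (bouquet p a V) a r"
  shows "depth (LQG (bouquet p a V) a r) = Max (label_sizes V)"
proof -
  let ?M = "bouquet p a V" and ?O = "nodes (bouquet p a V)"
  have "r ?O \<in> ?O" using r unfolding representatives_def node_orbits_bouquet by blast
  then obtain j where j: "r ?O = p + lat a j" unfolding nodes_bouquet by blast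
  have verts: "lverts (LQG ?M a r) = {?O}" and led: "ledges (LQG ?M a r) = edge_orbit a ` edges ?M"
    by (simp_all add: LQG_def node_orbits_bouquet)
  have dart: "(v, w, m) \<in> darts (LQG ?M a r) E \<longleftrightarrow> v = ?O \<and> w = ?O \<and>
      (\<exists>k l. m = k - l \<and> closed_segment (p + lat a (j + ivec_of k)) (p + lat a (j + ivec_of l)) \<in> E)"
    for v w m E
    unfolding LQG_def node_orbits_bouquet
    by (auto simp: translation_lat j lat_add add.assoc)
  have orbit: "E \<subseteq> edges ?M" if E: "E \<in> edge_orbit a ` edges ?M" for E
  proof -
    obtain k m where m: "m \<in> V" and "E = edge_orbit a (closed_segment (p + lat a k) (p + lat a (k + m)))"
      using E unfolding edges_bouquet by blast
    then show ?thesis unfolding edge_orbit_bouquet edges_bouquet using m by blast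
  qed
  have "(\<exists>e v w. e \<in> ledges (LQG ?M a r) \<and> (v, w, m) \<in> darts (LQG ?M a r) e) \<longleftrightarrow> ivec_of m \<in> V" for m
  proof
    assume "\<exists>e v w. e \<in> ledges (LQG ?M a r) \<and> (v, w, m) \<in> darts (LQG ?M a r) e"
    then obtain E k l where E: "E \<in> edge_orbit a ` edges ?M" "m = k - l"
      "closed_segment (p + lat a (j + ivec_of k)) (p + lat a (j + ivec_of l)) \<in> E"
      unfolding led dart by blast
    then have "closed_segment (p + lat a (j + ivec_of k)) (p + lat a (j + ivec_of l)) \<in> edges ?M"
      using orbit by blast
    then have "ivec_of l - ivec_of k \<in> V" by (simp add: edge_in_bouquet[OF a V])
    then have "- (ivec_of l - ivec_of k) \<in> V" using V unfolding symmetric_def by blast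
    then show "ivec_of m \<in> V" by (simp add: E(2) ivec_of_diff)
  next
    assume m: "ivec_of m \<in> V"
    have z: "ivec_of 0 = 0" by (simp add: ivec_of_def zero_prod_def)
    let ?e = "closed_segment (p + lat a (j + ivec_of m)) (p + lat a (j + ivec_of 0))"
    have "?e \<in> edges ?M"
      using m V by (simp add: edge_in_bouquet[OF a V] z symmetric_def)
    moreover have "?e \<in> edge_orbit a ?e"
      unfolding edge_orbit_lat by (rule range_eqI[of _ _ 0]) simp
    ultimately show "\<exists>e v w. e \<in> ledges (LQG ?M a r) \<and> (v, w, m) \<in> darts (LQG ?M a r) e"
      unfolding led dart
      by (intro exI[of _ "edge_orbit a ?e"] exI[of _ ?O] conjI imageI refl exI[of _ m] exI[of _ 0]) simp_all
  qed
  then have "{nat \<bar>m $ i\<bar> | e v w m i. e \<in> ledges (LQG ?M a r) \<and> (v, w, m) \<in> darts (LQG ?M a r) e}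
     = label_sizes V"
    unfolding label_sizes_def by blast
  then show ?thesis unfolding depth_def by simp
qed

lemma finite_label_sizes: assumes "finite V" shows "finite (label_sizes V)"
proof -
  have "finite (ivec_of -` V)" using assms bij_ivec_of by (intro finite_vimageI) (simp_all add: bij_is_inj)
  then have "finite ((\<lambda>(m, i). nat \<bar>m $ i\<bar>) ` ((ivec_of -` V) \<times> (UNIV :: 3 set)))" by simp
  moreover have "label_sizes V \<subseteq> (\<lambda>(m, i). nat \<bar>m $ i\<bar>) ` ((ivec_of -` V) \<times> (UNIV :: 3 set))"
    unfolding label_sizes_def by auto
  ultimately show ?thesis by (rule rev_finite_subset)
qed

text \<open>Labels are nonzero, so no labelled quotient graph has depth 0; the adjacency depth is thus 1 as
  soon as one primitive basis gives depth at most 1.\<close>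
lemma Max_label_sizes_pos:
  assumes fin: "finite V" and V: "0 \<notin> V" "V \<noteq> {}"
  shows "Max (label_sizes V) \<ge> 1"
proof -
  obtain v where v: "v \<in> V" using V by blast
  obtain m where m: "v = ivec_of m" using bij_ivec_of by (metis bij_is_surj surjD)
  have "m \<noteq> 0" using v V m by (auto simp: ivec_of_def zero_prod_def)
  then obtain i where "m $ i \<noteq> 0" by (auto simp: vec_eq_iff)
  moreover have "nat \<bar>m $ i\<bar> \<in> label_sizes V" using v m unfolding label_sizes_def by blast
  then have "nat \<bar>m $ i\<bar> \<le> Max (label_sizes V)" by (rule Max_ge[OF finite_label_sizes[OF fin]])
  ultimately show ?thesis by linarith
qed

lemma Max_label_sizes_le_1:
  assumes fin: "finite V" and ne: "V \<noteq> {}"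
  shows "Max (label_sizes V) \<le> 1 \<longleftrightarrow> (\<forall>v\<in>V. depth_one v)"
proof -
  obtain m where "ivec_of m \<in> V" using ne bij_ivec_of by (metis all_not_in_conv bij_is_surj surjD)
  then have "nat \<bar>m $ 1\<bar> \<in> label_sizes V" unfolding label_sizes_def by blast
  then have "Max (label_sizes V) \<le> 1 \<longleftrightarrow> (\<forall>n\<in>label_sizes V. n \<le> 1)"
    by (intro Max_le_iff finite_label_sizes[OF fin]) auto
  also have "\<dots> \<longleftrightarrow> (\<forall>m. ivec_of m \<in> V \<longrightarrow> (\<forall>i. \<bar>m $ i\<bar> \<le> 1))"
  proof (intro iffI allI impI ballI)
    fix m i assume le: "\<forall>n\<in>label_sizes V. n \<le> 1" and "ivec_of m \<in> V"
    then have "nat \<bar>m $ i\<bar> \<in> label_sizes V" unfolding label_sizes_def by blast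
    with le have "nat \<bar>m $ i\<bar> \<le> 1" by blast
    then show "\<bar>m $ i\<bar> \<le> 1" by linarith
  next
    fix n assume le: "\<forall>m. ivec_of m \<in> V \<longrightarrow> (\<forall>i. \<bar>m $ i\<bar> \<le> 1)" and "n \<in> label_sizes V"
    then obtain m i where "n = nat \<bar>m $ i\<bar>" "ivec_of m \<in> V" unfolding label_sizes_def by blast
    with le show "n \<le> 1" by (simp add: nat_le_iff)
  qed
  also have "\<dots> \<longleftrightarrow> (\<forall>m. ivec_of m \<in> V \<longrightarrow> depth_one (ivec_of m))"
    by (simp add: forall_3 ivec_of_def depth_one_def)
  also have "\<dots> \<longleftrightarrow> (\<forall>v\<in>V. depth_one v)"
    using bij_ivec_of by (metis bij_is_surj surjD)
  finally show ?thesis .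
qed

lemma representatives_exist: "\<exists>r. representatives M a r"
proof -
  have "\<exists>y. y \<in> v" if "v \<in> node_orbit a ` nodes M" for v
    using that by (auto simp: node_orbit_lat)
  then show ?thesis
    unfolding representatives_def by (intro exI[of _ "\<lambda>v. SOME y. y \<in> v"]) (simp add: some_in_eq ex_in_conv)
qed

lemma target_nets_bouquet:
  assumes "M \<in> target_nets"
  obtains p a V where "M = bouquet p a V" "det a \<noteq> 0" "admissible V" "generating V"
proof -
  from assms have lin: "linear_net M" and con: "connected_net M" and ad: "adjacency_depth M = 1"
    and "\<exists>G. quotient_graph_of M G \<and> card (gverts G) = 1"
    by (auto simp: target_nets_def)
  then obtain a0 where prim0: "primitive_basis M a0" and card: "card (node_orbit a0 ` nodes M) = 1"
    by (auto simp: quotient_graph_of_def underlying_multigraph_def LQG_def)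
  have per0: "periodicity_basis M a0" using prim0 by (simp add: primitive_basis_def)
  have "nodes M \<noteq> {}" using card by (metis card.empty image_empty zero_neq_one)
  then obtain p0 where p0: "p0 \<in> nodes M" by (metis ex_in_conv)
  have self: "x \<in> node_orbit a0 x" for x
    unfolding node_orbit_lat by (rule range_eqI[of _ _ 0]) simp
  have nodes0: "nodes M = node_orbit a0 p0"
  proof (intro equalityI subsetI)
    fix x assume x: "x \<in> nodes M"
    obtain Q where Q: "node_orbit a0 ` nodes M = {Q}" using card by (rule card_1_singletonE)
    have "node_orbit a0 x = Q" "node_orbit a0 p0 = Q"
      using imageI[OF x, of "node_orbit a0"] imageI[OF p0, of "node_orbit a0"] unfolding Q by simp_all
    then have "node_orbit a0 x = node_orbit a0 p0" by simp
    then show "x \<in> node_orbit a0 p0" using self by blast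
  next
    fix x assume "x \<in> node_orbit a0 p0"
    then obtain k where k: "x = p0 + lat a0 k" unfolding node_orbit_lat by blast
    have "(\<lambda>x. x + lat a0 k) ` nodes M = nodes M" using per0 unfolding periodicity_basis_lat by blast
    then show "x \<in> nodes M" unfolding k using p0 by blast
  qed
  \<comment> \<open>\<open>a0\<close> only provides the single orbit; the basis \<open>a\<close> of minimal depth spans the same lattice\<close>
  let ?S = "{depth (LQG M a r) | a r. primitive_basis M a \<and> representatives M a r}"
  have "?S \<noteq> {}" using prim0 representatives_exist[of M a0] by blast
  then have "Inf ?S \<in> ?S" by (rule Inf_nat_def1)
  then obtain a r where prim: "primitive_basis M a" and r: "representatives M a r"
    and depth: "depth (LQG M a r) = 1"
    using ad unfolding adjacency_depth_def by (smt (verit) mem_Collect_eq)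
  have per: "periodicity_basis M a" using prim by (simp add: primitive_basis_def)
  then have det: "det a \<noteq> 0" by (simp add: periodicity_basis_lat)
  have "translation_group a = translation_group a0"
    by (rule primitive_basis_single_orbit(2)[OF per0 nodes0 prim])
  then have "nodes M = node_orbit a p0" unfolding nodes0 node_orbit_def by simp
  then obtain V where M: "M = bouquet p0 a V" and V: "symmetric V" "0 \<notin> V" "finite V"
    using single_orbit_bouquet[OF lin per] by blast
  have "V \<noteq> {}"
  proof
    assume "V = {}"
    then have "edges M = {}" unfolding M edges_bouquet by blast
    then show False using linear_net_nodeE[OF lin p0] by blast
  qed
  moreover have "Max (label_sizes V) = 1"
    using depth depth_LQG_bouquet[OF det V(1) r[unfolded M]] unfolding M by simp
  ultimately have "\<forall>v\<in>V. depth_one v" using Max_label_sizes_le_1[OF V(3)] by simp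
  moreover have "noncrossing V"
    using lin noncrossing_if_disjoint[OF det V(1,2)] unfolding M linear_net_def by blast
  ultimately have "admissible V" using V by (simp add: admissible_def)
  moreover have "generating V" using con connected_bouquet[OF det V(1)] unfolding M by blast
  ultimately show thesis using that M det by blast
qed

lemma bouquet_target_nets:
  assumes det: "det a \<noteq> 0" and V: "admissible V" "generating V"
  shows "bouquet p a V \<in> target_nets"
proof -
  let ?M = "bouquet p a V"
  have sym: "symmetric V" using V by (simp add: admissible_def)
  have fin: "finite V" by (rule finite_admissible[OF V(1)])
  have ne: "V \<noteq> {}"
  proof
    assume "V = {}"
    then have "label_ball V n = {0}" for n by (induction n) auto
    moreover obtain n where "(1,0,0) \<in> label_ball V n" using V(2) unfolding generating_def by blast
    ultimately show False by (simp add: zero_prod_def)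
  qed
  have lin: "linear_net ?M" by (rule linear_net_bouquet[OF det V(1) ne])
  have per: "periodicity_basis ?M a" by (rule periodicity_basis_bouquet[OF det fin])
  have p: "p \<in> nodes ?M" unfolding nodes_bouquet by (rule range_eqI[of _ _ 0]) simp
  have nodes: "nodes ?M = node_orbit a p" using node_orbit_bouquet[OF p] by simp
  have prim: "primitive_basis ?M a" by (rule primitive_basis_single_orbit(1)[OF per nodes])
  obtain r where r: "representatives ?M a r" using representatives_exist by blast
  have "card (gverts (underlying_multigraph (LQG ?M a r))) = 1"
    by (simp add: underlying_multigraph_def LQG_def node_orbits_bouquet)
  then have q: "\<exists>G. quotient_graph_of ?M G \<and> card (gverts G) = 1"
    unfolding quotient_graph_of_def using prim r by blast
  let ?S = "{depth (LQG ?M a r) | a r. primitive_basis ?M a \<and> representatives ?M a r}"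
  have ge: "d \<ge> 1" if dS: "d \<in> ?S" for d
  proof -
    obtain b s where d: "d = depth (LQG ?M b s)" and b: "primitive_basis ?M b" and s: "representatives ?M b s"
      using dS by blast
    have perb: "periodicity_basis ?M b" using b by (simp add: primitive_basis_def)
    have detb: "det b \<noteq> 0" using perb by (simp add: periodicity_basis_lat)
    have "translation_group b = translation_group a"
      by (rule primitive_basis_single_orbit(2)[OF per nodes b])
    then have "nodes ?M = node_orbit b p" unfolding nodes node_orbit_def by simp
    then obtain W where M: "?M = bouquet p b W" and W: "symmetric W" "0 \<notin> W" "finite W"
      using single_orbit_bouquet[OF lin perb] by blast
    have "W \<noteq> {}"
    proof
      assume "W = {}"
      then have "edges ?M = {}" unfolding M edges_bouquet by blast
      then show False using linear_net_nodeE[OF lin p] by blast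
    qed
    then show ?thesis
      unfolding d M using depth_LQG_bouquet[OF detb W(1) s[unfolded M]] Max_label_sizes_pos[OF W(3,2)] by simp
  qed
  have "depth (LQG ?M a r) = Max (label_sizes V)" by (rule depth_LQG_bouquet[OF det sym r])
  moreover have "Max (label_sizes V) \<le> 1"
    using Max_label_sizes_le_1[OF fin ne] V(1) unfolding admissible_def by blast
  moreover have S: "depth (LQG ?M a r) \<in> ?S" using prim r by blast
  moreover have "1 \<le> depth (LQG ?M a r)" by (rule ge[OF S])
  ultimately have "depth (LQG ?M a r) = 1" by linarith
  with S have "1 \<in> ?S" by (simp only:)
  then have "Inf ?S = 1" using ge by (intro cInf_eq_minimum)
  moreover have "connected_net ?M" using V(2) connected_bouquet[OF det sym] by blast
  ultimately show ?thesis
    unfolding target_nets_def adjacency_depth_def using lin q by blast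
qed

section \<open>The models and the reduction procedure\<close>
text \<open>The 13 pairs of opposite nonzero vectors with entries in \<open>{-1, 0, 1}\<close>, one vector of each pair,
  grouped by their class modulo 2.\<close>
definition label_classes :: "ivec list list" where
  "label_classes = [[(1,0,0)], [(0,1,0)], [(0,0,1)], [(0,1,1), (0,1,-1)], [(1,0,1), (1,0,-1)],
     [(1,1,0), (1,-1,0)], [(1,1,1), (1,1,-1), (1,-1,1), (1,-1,-1)]]"

text \<open>At most one label from each class: \<open>2\<^sup>3 * 3\<^sup>3 * 5 = 1080\<close> lists.\<close>
definition candidates :: "ivec list list" where
  "candidates = map concat (product_lists (map (\<lambda>c. [] # map (\<lambda>v. [v]) c) label_classes))"

text \<open>Found by search together with \<open>weight\<close>: a small set of automorphisms such that every generating
  candidate outside of \<open>model_labels\<close> is mapped to one of smaller weight by one of them.\<close>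
definition moves :: "(ivec \<Rightarrow> ivec) list" where
  "moves = [\<lambda>(x,y,z). (y, -x, z), \<lambda>(x,y,z). (-z, z - y, -x), \<lambda>(x,y,z). (-z, -y, -x),
     \<lambda>(x,y,z). (x + y, z, -y), \<lambda>(x,y,z). (-x, z, y), \<lambda>(x,y,z). (z, y, -x - z),
     \<lambda>(x,y,z). (-z, x + z, -x - y), \<lambda>(x,y,z). (z, -y, x), \<lambda>(x,y,z). (z, y, -x)]"

text \<open>Even in \<open>v\<close>, hence defined on labels up to sign. The two linear forms are chosen such that every
  equivalence class of generating candidates has a unique lightest member; these are the models.\<close>
definition weight :: "ivec \<Rightarrow> int" where
  "weight v = (case v of (x,y,z) \<Rightarrow> \<bar>2 * y - 10 * x - 11 * z\<bar> + \<bar>17 * x + 8 * y + 13 * z\<bar>)"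

definition total_weight :: "ivec list \<Rightarrow> int" where
  "total_weight xs = sum_list (map weight xs)"

text \<open>Each pair \<open>(p, c)\<close> stands for the homomorphism \<open>c\<close> modulo \<open>p\<close>. A candidate that no move improves
  is a model or lies in the kernel of one of these four.\<close>
definition functionals :: "(int \<times> ivec) list" where
  "functionals = [(2, (1,0,1)), (2, (0,1,1)), (3, (1,-1,-1)), (3, (1,1,1))]"

definition functional_value :: "ivec \<Rightarrow> ivec \<Rightarrow> int" where
  "functional_value c v = (case c of (a,b,c) \<Rightarrow> case v of (x,y,z) \<Rightarrow> a * x + b * y + c * z)"

definition degenerate :: "ivec list \<Rightarrow> bool" where
  "degenerate xs = list_ex (\<lambda>(p, c). list_all (\<lambda>v. functional_value c v mod p = 0) xs) functionals"

text \<open>One label from each opposite pair; the lists have length 3 to 7, the number of loops.\<close>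
definition model_labels :: "ivec list list" where
  "model_labels = [
    [(0, 1, - 1), (1, 0, - 1), (1, - 1, - 1)],
    [(0, 0, 1), (0, 1, - 1), (1, 0, - 1), (1, - 1, - 1)],
    [(0, 1, 0), (0, 1, - 1), (1, 1, 0), (1, - 1, - 1)],
    [(0, 1, 0), (0, 1, - 1), (1, 0, - 1), (1, - 1, - 1)],
    [(1, 0, 0), (0, 1, - 1), (1, 0, - 1), (1, - 1, - 1)],
    [(0, 1, - 1), (1, 0, - 1), (1, 1, 0), (1, - 1, - 1)],
    [(0, 1, 0), (0, 1, - 1), (1, 0, - 1), (1, - 1, 0), (1, - 1, - 1)],
    [(1, 0, 0), (0, 1, 0), (0, 1, - 1), (1, 0, - 1), (1, - 1, - 1)],
    [(0, 1, 0), (0, 1, - 1), (1, 0, - 1), (1, 1, 0), (1, - 1, - 1)],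
    [(0, 0, 1), (0, 1, - 1), (1, 0, - 1), (1, 1, 0), (1, - 1, - 1)],
    [(0, 1, 0), (0, 1, - 1), (1, 0, - 1), (1, - 1, 0), (1, 1, 1)],
    [(1, 0, 0), (0, 1, 0), (0, 1, - 1), (1, 0, - 1), (1, - 1, 0), (1, - 1, - 1)],
    [(1, 0, 0), (0, 0, 1), (0, 1, - 1), (1, 0, - 1), (1, 1, 0), (1, - 1, - 1)],
    [(0, 1, 0), (0, 0, 1), (0, 1, - 1), (1, 0, - 1), (1, 1, 0), (1, - 1, - 1)],
    [(0, 1, 0), (0, 0, 1), (0, 1, - 1), (1, 0, - 1), (1, - 1, 0), (1, 1, 1)],
    [(0, 1, 0), (0, 0, 1), (0, 1, - 1), (1, 0, - 1), (1, - 1, 0), (1, - 1, - 1)],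
    [(1, 0, 0), (0, 1, 0), (0, 0, 1), (0, 1, - 1), (1, 0, - 1), (1, - 1, 0), (1, - 1, - 1)],
    [(1, 0, 0), (0, 1, 0), (0, 0, 1), (0, 1, - 1), (1, 0, - 1), (1, 1, 0), (1, - 1, - 1)],
    [(1, 0, 0), (0, 1, 0), (0, 0, 1), (0, 1, - 1), (1, 0, - 1), (1, - 1, 0), (1, 1, 1)]]"

definition improves :: "(ivec \<Rightarrow> ivec) \<Rightarrow> ivec list \<Rightarrow> bool" where
  "improves u xs = (list_all depth_one (map u xs) \<and> total_weight (map u xs) < total_weight xs)"

section \<open>Equivalence of label sets\<close>
lemma lattice_autI:
  assumes "\<And>k l. u (k + l) = u k + u l" "\<And>k. w (u k) = k" "\<And>k. u (w k) = k"
  shows "lattice_aut u"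
  unfolding lattice_aut_def
proof
  show "bij u" by (rule o_bij[of w]) (simp_all add: fun_eq_iff assms)
qed (simp add: assms)

lemma lattice_aut_inv:
  assumes "lattice_aut u" shows "lattice_aut (inv u)"
proof -
  have bij: "bij u" using assms by (simp add: lattice_aut_def)
  have "inv u (k + l) = inv u k + inv u l" for k l
  proof -
    have "u (inv u k + inv u l) = k + l"
      using bij by (simp add: lattice_aut_add[OF assms] bij_is_surj surj_f_inv_f)
    then show ?thesis using bij by (metis bij_inv_eq_iff)
  qed
  then show ?thesis using bij by (simp add: lattice_aut_def bij_imp_bij_inv)
qed

lemma equivalent_labels_refl: "equivalent_labels V V"
  unfolding equivalent_labels_def
  by (intro exI[of _ "\<lambda>k. k"] conjI lattice_autI[of _ "\<lambda>k. k"]) simp_all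

lemma equivalent_labels_back:
  assumes "lattice_aut u" "equivalent_labels W (u ` V)" shows "equivalent_labels W V"
proof -
  obtain v where v: "lattice_aut v" "u ` V = v ` W"
    using assms(2) by (auto simp: equivalent_labels_def)
  have "inv u ` u ` V = V" using assms(1) by (simp add: lattice_aut_def bij_is_inj image_image)
  then have V: "V = (inv u \<circ> v) ` W" unfolding v(2) by (simp add: image_comp)
  have "lattice_aut (inv u \<circ> v)"
    using v(1) lattice_aut_inv[OF assms(1)] by (auto simp: lattice_aut_def intro: bij_comp)
  with V show ?thesis unfolding equivalent_labels_def by blast
qed

lemma even_ivec_iff: "even_ivec v \<longleftrightarrow> (\<exists>d. v = d + d)"
proof
  assume "even_ivec v"
  then have "v = (fst v div 2, fst (snd v) div 2, snd (snd v) div 2)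
     + (fst v div 2, fst (snd v) div 2, snd (snd v) div 2)"
    by (cases v) (simp add: even_ivec_def)
  then show "\<exists>d. v = d + d" by (rule exI)
next
  assume "\<exists>d. v = d + d"
  then obtain d where "v = d + d" by blast
  then show "even_ivec v" by (cases d) (simp add: even_ivec_def)
qed

text \<open>Automorphisms preserve congruence modulo 2, so only the depth has to be checked.\<close>
lemma admissible_image:
  assumes u: "lattice_aut u" and V: "admissible V" and d: "\<forall>v\<in>V. depth_one (u v)"
  shows "admissible (u ` V)"
proof -
  have inj: "u k = u l \<longleftrightarrow> k = l" for k l
    using u by (auto simp: lattice_aut_def bij_def inj_def)
  have "symmetric (u ` V)"
    unfolding symmetric_def
  proof
    fix x assume "x \<in> u ` V"
    then obtain v where "v \<in> V" "x = u v" by blast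
    moreover from this have "- v \<in> V" using V unfolding admissible_def symmetric_def by blast
    ultimately show "- x \<in> u ` V" using lattice_aut_minus[OF u, of v] by (metis imageI)
  qed
  moreover have "0 \<notin> u ` V"
  proof
    assume "0 \<in> u ` V"
    then obtain v where v: "v \<in> V" "u v = 0" by (metis imageE)
    then have "v = 0" using inj[of v 0] lattice_aut_0[OF u] by simp
    then show False using V v(1) unfolding admissible_def by blast
  qed
  moreover have "noncrossing (u ` V)"
    unfolding noncrossing_def
  proof (intro ballI impI)
    fix v' w' assume "v' \<in> u ` V" "w' \<in> u ` V" and even: "even_ivec (v' - w')"
    then obtain v w where vw: "v \<in> V" "w \<in> V" "v' = u v" "w' = u w" by blast
    obtain d where "v' - w' = d + d" using even even_ivec_iff by blast
    moreover obtain e where "d = u e" using u by (metis lattice_aut_def bij_is_surj surjD)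
    ultimately have "u (v + - w) = u (e + e)"
      unfolding lattice_aut_add[OF u] lattice_aut_minus[OF u] by (simp add: vw)
    then have "v - w = e + e" unfolding inj by simp
    then have "even_ivec (v - w)" using even_ivec_iff by blast
    then have "w = v \<or> w = - v" using V vw unfolding admissible_def noncrossing_def by blast
    then show "w' = v' \<or> w' = - v'"
      unfolding vw(3,4) using lattice_aut_minus[OF u, of v] by metis
  qed
  ultimately show ?thesis using d by (simp add: admissible_def)
qed

lemma label_ball_image:
  assumes u: "lattice_aut u" shows "label_ball (u ` V) n = u ` label_ball V n"
proof (induction n)
  case 0
  then show ?case by (simp add: lattice_aut_0[OF u])
next
  case (Suc n)
  have "{k + m | k m. k \<in> u ` label_ball V n \<and> m \<in> u ` V}
     = u ` {k + m | k m. k \<in> label_ball V n \<and> m \<in> V}" (is "?L = ?R")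
  proof (intro equalityI subsetI)
    fix x assume "x \<in> ?L"
    then obtain k m where km: "k \<in> label_ball V n" "m \<in> V" "x = u k + u m" by blast
    have "x = u (k + m)" unfolding km(3) by (rule lattice_aut_add[OF u, symmetric])
    then show "x \<in> ?R" using km(1,2) by blast
  next
    fix x assume "x \<in> ?R"
    then obtain k m where km: "k \<in> label_ball V n" "m \<in> V" "x = u (k + m)" by blast
    have "x = u k + u m" unfolding km(3) by (rule lattice_aut_add[OF u])
    then show "x \<in> ?L" using km(1,2) by blast
  qed
  then show ?case by (simp only: label_ball.simps Suc image_Un)
qed

lemma generating_image:
  assumes u: "lattice_aut u" and V: "generating V" shows "generating (u ` V)"
  unfolding generating_def label_ball_image[OF u]
proof
  fix k
  obtain l where l: "k = u l" using u by (metis lattice_aut_def bij_is_surj surjD)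
  obtain n where "l \<in> label_ball V n" using V unfolding generating_def by blast
  then show "\<exists>n. k \<in> u ` label_ball V n" unfolding l by blast
qed

section \<open>Every admissible generating label set is equivalent to a model\<close>
definition label_set :: "ivec list \<Rightarrow> ivec set" where
  "label_set xs = set xs \<union> uminus ` set xs"

definition label_list :: "ivec set \<Rightarrow> ivec list" where
  "label_list V = concat (map (filter (\<lambda>v. v \<in> V)) label_classes)"

lemma filter_singleton:
  assumes "distinct c" "\<And>v w. v \<in> set c \<Longrightarrow> w \<in> set c \<Longrightarrow> P v \<Longrightarrow> P w \<Longrightarrow> v = w"
  shows "filter P c \<in> set ([] # map (\<lambda>v. [v]) c)"
proof (cases "filter P c")
  case (Cons v vs)
  have "vs = []"
  proof (rule ccontr)
    assume "vs \<noteq> []"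
    then obtain w ws where "vs = w # ws" by (cases vs) auto
    with Cons have f: "filter P c = v # w # ws" by simp
    then have "v \<in> set (filter P c)" "w \<in> set (filter P c)" by simp_all
    then have "v = w" using assms(2) by simp
    moreover have "distinct (filter P c)" using assms(1) by simp
    ultimately show False unfolding f by simp
  qed
  have "v \<in> set (filter P c)" using Cons by simp
  then have "v \<in> set c" by simp
  then show ?thesis using Cons \<open>vs = []\<close> by simp
qed simp

lemma label_classes_congruent:
  assumes "c \<in> set label_classes" "v \<in> set c" "w \<in> set c"
  shows "even_ivec (v - w) \<and> w \<noteq> - v"
proof -
  have "\<forall>c\<in>set label_classes. \<forall>v\<in>set c. \<forall>w\<in>set c. even_ivec (v - w) \<and> w \<noteq> - v"
    by (simp add: label_classes_def even_ivec_def zero_prod_def)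
  with assms show ?thesis by blast
qed

lemma label_list_candidate:
  assumes V: "admissible V" shows "label_list V \<in> set candidates"
proof -
  have "filter (\<lambda>v. v \<in> V) c \<in> set ([] # map (\<lambda>v. [v]) c)" if c: "c \<in> set label_classes" for c
  proof (rule filter_singleton)
    have "\<forall>c\<in>set label_classes. distinct c" by (simp add: label_classes_def)
    then show "distinct c" using c by blast
    fix v w assume "v \<in> set c" "w \<in> set c" "v \<in> V" "w \<in> V"
    then show "v = w"
      using label_classes_congruent[OF c, of v w] V unfolding admissible_def noncrossing_def by blast
  qed
  then have "map (filter (\<lambda>v. v \<in> V)) label_classes
      \<in> set (product_lists (map (\<lambda>c. [] # map (\<lambda>v. [v]) c) label_classes))"
    unfolding product_lists_set by (simp add: list_all2_conv_all_nth)
  then show ?thesis unfolding candidates_def label_list_def by simp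
qed

lemma depth_one_cases:
  assumes "depth_one v" "v \<noteq> 0"
  shows "v \<in> label_set (concat label_classes)"
proof -
  obtain x y z where v: "v = (x, y, z)" by (cases v)
  have *: "w \<in> {-1, 0, 1}" if "\<bar>w\<bar> \<le> 1" for w :: int using that by auto
  have "x \<in> {-1,0,1}" "y \<in> {-1,0,1}" "z \<in> {-1,0,1}"
    using assms(1) * by (simp_all add: depth_one_def v)
  then show ?thesis
    using assms(2) unfolding v insert_iff empty_iff
    by (elim disjE) (simp_all add: label_set_def label_classes_def zero_prod_def)
qed

lemma label_set_label_list:
  assumes V: "admissible V" shows "label_set (label_list V) = V"
proof -
  have s: "set (label_list V) = set (concat label_classes) \<inter> V"
    unfolding label_list_def by auto
  have sym: "- v \<in> V" if "v \<in> V" for v using V that unfolding admissible_def symmetric_def by blast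
  show ?thesis
  proof (intro equalityI subsetI)
    fix v assume "v \<in> label_set (label_list V)"
    then show "v \<in> V" unfolding label_set_def s using sym by blast
  next
    fix v assume v: "v \<in> V"
    then have "depth_one v" "v \<noteq> 0" using V unfolding admissible_def by blast+
    then have "v \<in> label_set (concat label_classes)" by (rule depth_one_cases)
    then consider "v \<in> set (concat label_classes)" | w where "w \<in> set (concat label_classes)" "v = - w"
      unfolding label_set_def by blast
    then show "v \<in> label_set (label_list V)"
    proof cases
      case 1
      then show ?thesis using v unfolding label_set_def s by blast
    next
      case 2
      then have "w \<in> V" using sym[OF v] by simp
      then show ?thesis using 2 unfolding label_set_def s by blast
    qed
  qed
qed

text \<open>Each label of the list contributes together with its negative.\<close>
lemma sum_label_set:
  assumes even: "\<And>v. f (- v) = f v"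
  shows "sum f (label_set (label_list V)) = (2 * sum_list (map f (label_list V)) :: int)"
proof -
  let ?xs = "label_list V"
  have all: "distinct (concat label_classes)" "set (concat label_classes) \<inter> uminus ` set (concat label_classes) = {}"
    by (simp_all add: label_classes_def)
  have fc: "?xs = filter (\<lambda>v. v \<in> V) (concat label_classes)"
    by (simp add: label_list_def filter_concat)
  have d: "distinct ?xs" unfolding fc using all(1) by (rule distinct_filter)
  have "set ?xs \<inter> uminus ` set ?xs = {}" using all(2) unfolding fc by auto
  then have "sum f (label_set ?xs) = sum f (set ?xs) + sum f (uminus ` set ?xs)"
    unfolding label_set_def by (intro sum.union_disjoint) simp_all
  also have "sum f (uminus ` set ?xs) = sum f (set ?xs)"
    by (subst sum.reindex) (simp_all add: even)
  also have "sum f (set ?xs) = sum_list (map f ?xs)"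
    using d by (simp add: sum_list_distinct_conv_sum_set)
  finally show ?thesis by simp
qed

lemma moves_aut:
  assumes "u \<in> set moves" shows "lattice_aut u"
proof -
  have "lattice_aut (\<lambda>(x,y,z). (y, -x, z))"
    by (rule lattice_autI[of _ "\<lambda>(x,y,z). (-y, x, z)"]) (simp_all split: prod.split)
  moreover have "lattice_aut (\<lambda>(x,y,z). (-z, z - y, -x))"
    by (rule lattice_autI[of _ "\<lambda>(x,y,z). (-z, -x - y, -x)"]) (simp_all split: prod.split)
  moreover have "lattice_aut (\<lambda>(x,y,z). (-z, -y, -x))"
    by (rule lattice_autI[of _ "\<lambda>(x,y,z). (-z, -y, -x)"]) (simp_all split: prod.split)
  moreover have "lattice_aut (\<lambda>(x,y,z). (x + y, z, -y))"
    by (rule lattice_autI[of _ "\<lambda>(x,y,z). (x + z, -z, y)"]) (simp_all split: prod.split)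
  moreover have "lattice_aut (\<lambda>(x,y,z). (-x, z, y))"
    by (rule lattice_autI[of _ "\<lambda>(x,y,z). (-x, z, y)"]) (simp_all split: prod.split)
  moreover have "lattice_aut (\<lambda>(x,y,z). (z, y, -x - z))"
    by (rule lattice_autI[of _ "\<lambda>(x,y,z). (-x - z, y, x)"]) (simp_all split: prod.split)
  moreover have "lattice_aut (\<lambda>(x,y,z). (-z, x + z, -x - y))"
    by (rule lattice_autI[of _ "\<lambda>(x,y,z). (x + y, -x - y - z, -x)"]) (simp_all split: prod.split)
  moreover have "lattice_aut (\<lambda>(x,y,z). (z, -y, x))"
    by (rule lattice_autI[of _ "\<lambda>(x,y,z). (z, -y, x)"]) (simp_all split: prod.split)
  moreover have "lattice_aut (\<lambda>(x,y,z). (z, y, -x))"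
    by (rule lattice_autI[of _ "\<lambda>(x,y,z). (-z, y, x)"]) (simp_all split: prod.split)
  ultimately show ?thesis using assms unfolding moves_def by auto
qed

lemma functional_value_add: "functional_value c (k + l) = functional_value c k + functional_value c l"
  by (cases c; cases k; cases l) (simp add: functional_value_def algebra_simps)

lemma functional_value_minus: "functional_value c (- k) = - functional_value c k"
  by (cases c; cases k) (simp add: functional_value_def algebra_simps)

lemma degenerate_not_generating:
  assumes "degenerate xs" shows "\<not> generating (label_set xs)"
proof
  assume gen: "generating (label_set xs)"
  obtain p c where pc: "(p, c) \<in> set functionals"
    and xs: "\<And>v. v \<in> set xs \<Longrightarrow> p dvd functional_value c v"
    using assms unfolding degenerate_def by (auto simp: list_ex_iff list_all_iff dvd_eq_mod_eq_0)
  have V: "p dvd functional_value c v" if "v \<in> label_set xs" for v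
    using that unfolding label_set_def
  proof (elim UnE imageE)
    assume "v \<in> set xs" then show ?thesis by (rule xs)
  next
    fix w assume w: "v = - w" "w \<in> set xs"
    show ?thesis unfolding w(1) functional_value_minus using xs[OF w(2)] by simp
  qed
  have ball: "p dvd functional_value c k" if "k \<in> label_ball (label_set xs) n" for k n
    using that
  proof (induction n arbitrary: k)
    case 0
    then show ?case by (cases c) (simp add: functional_value_def zero_prod_def)
  next
    case (Suc n)
    then consider "k \<in> label_ball (label_set xs) n"
      | l v where "k = l + v" "l \<in> label_ball (label_set xs) n" "v \<in> label_set xs" by auto
    then show ?case
    proof cases
      case 1 then show ?thesis by (rule Suc.IH)
    next
      case 2
      then show ?thesis using Suc.IH V by (simp add: functional_value_add)
    qed
  qed
  \<comment> \<open>all four functionals take the value \<open>1\<close> or \<open>-1\<close> at this vector\<close>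
  obtain n where "(0,0,1) \<in> label_ball (label_set xs) n" using gen unfolding generating_def by blast
  then have "p dvd functional_value c (0,0,1)" by (rule ball)
  moreover have "\<not> p dvd functional_value c (0,0,1)"
    using pc by (auto simp: functionals_def functional_value_def)
  ultimately show False by blast
qed

text \<open>The finite core of the classification: among the 1080 candidates, those that no move improves are
  the 19 models and 11 label sets that do not generate the lattice.\<close>
lemma reduction_check:
  "list_all (\<lambda>xs. list_ex (\<lambda>u. improves u xs) moves \<or> list_ex ((=) xs) model_labels \<or> degenerate xs) candidates"
  by code_simp

text \<open>Induction on the weight, with one application of \<open>reduction_check\<close> per step.\<close>
lemma equivalent_to_model:
  assumes "admissible V" "generating V"
  shows "\<exists>W\<in>set model_labels. equivalent_labels (label_set W) V"
  using assms
proof (induction "nat (sum weight V)" arbitrary: V rule: less_induct)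
  case less
  let ?xs = "label_list V"
  have V: "label_set ?xs = V" by (rule label_set_label_list[OF less.prems(1)])
  have "(\<exists>u\<in>set moves. improves u ?xs) \<or> ?xs \<in> set model_labels \<or> degenerate ?xs"
    using reduction_check label_list_candidate[OF less.prems(1)] by (auto simp: list_all_iff list_ex_iff)
  then consider u where "u \<in> set moves" "improves u ?xs" | "?xs \<in> set model_labels" | "degenerate ?xs" by blast
  then show ?case
  proof cases
    case 1
    have u: "lattice_aut u" by (rule moves_aut[OF 1(1)])
    have inj: "inj_on u V" using u by (auto simp: lattice_aut_def bij_def intro: inj_on_subset)
    have weight_minus: "weight (- v) = weight v" for v by (cases v) (simp add: weight_def)
    have depth_minus: "depth_one (- v) = depth_one v" for v by (cases v) (simp add: depth_one_def)
    have xs: "depth_one (u v)" if "v \<in> set ?xs" for v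
      using 1(2) that by (simp add: improves_def list_all_iff)
    have "depth_one (u v)" if "v \<in> label_set ?xs" for v
      using that unfolding label_set_def
    proof (elim UnE imageE)
      fix w assume w: "v = - w" "w \<in> set ?xs"
      show ?thesis unfolding w(1) lattice_aut_minus[OF u] depth_minus by (rule xs[OF w(2)])
    qed (rule xs)
    then have "\<forall>v\<in>label_set ?xs. depth_one (u v)" by (rule ballI)
    then have adm: "admissible (u ` V)" unfolding V by (rule admissible_image[OF u less.prems(1)])
    have gen: "generating (u ` V)" by (rule generating_image[OF u less.prems(2)])
    have "sum weight (u ` V) = sum (\<lambda>v. weight (u v)) V"
      using inj by (simp add: sum.reindex)
    also have "\<dots> = 2 * total_weight (map u ?xs)"
      using sum_label_set[of "\<lambda>v. weight (u v)" V]
      by (simp add: V lattice_aut_minus[OF u] weight_minus total_weight_def comp_def)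
    also have "\<dots> < 2 * total_weight ?xs" using 1(2) by (simp add: improves_def)
    also have "\<dots> = sum weight V"
      using sum_label_set[of weight V] by (simp add: V weight_minus total_weight_def)
    finally have lt: "sum weight (u ` V) < sum weight V" .
    have "weight v \<ge> 0" for v by (cases v) (simp add: weight_def)
    then have "sum weight (u ` V) \<ge> 0" by (simp add: sum_nonneg)
    with lt have "nat (sum weight (u ` V)) < nat (sum weight V)" by simp
    from less.hyps[OF this adm gen] show ?thesis using equivalent_labels_back[OF u] by blast
  next
    case 2
    moreover have "equivalent_labels (label_set ?xs) V" unfolding V by (rule equivalent_labels_refl)
    ultimately show ?thesis by blast
  next
    case 3
    then have "\<not> generating (label_set ?xs)" by (rule degenerate_not_generating)
    then have "\<not> generating V" unfolding V .
    then show ?thesis using less.prems(2) by (rule notE)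
  qed
qed

section \<open>The models are admissible, generating and pairwise distinct\<close>
lemma label_ball_add:
  assumes "k \<in> label_ball V m" "l \<in> label_ball V n" shows "k + l \<in> label_ball V (m + n)"
  using assms(2)
proof (induction n arbitrary: l)
  case 0
  then show ?case using assms(1) by simp
next
  case (Suc n)
  then consider "l \<in> label_ball V n" | l' v where "l = l' + v" "l' \<in> label_ball V n" "v \<in> V" by auto
  then show ?case
  proof cases
    case 1
    then show ?thesis using Suc.IH[of l] by simp
  next
    case 2
    then have "k + l' \<in> label_ball V (m + n)" using Suc.IH by blast
    then have "(k + l') + v \<in> label_ball V (Suc (m + n))" using 2(3) by auto
    then show ?thesis by (simp only: 2(1) add.assoc add_Suc_right)
  qed
qed

lemma label_ball_minus:
  assumes "symmetric V" "k \<in> label_ball V n" shows "- k \<in> label_ball V n"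
  using assms(2)
proof (induction n arbitrary: k)
  case (Suc n)
  then consider "k \<in> label_ball V n" | l v where "k = l + v" "l \<in> label_ball V n" "v \<in> V" by auto
  then show ?case
  proof cases
    case 1
    then show ?thesis using Suc.IH by simp
  next
    case 2
    then have "- l \<in> label_ball V n" "- v \<in> V" using Suc.IH assms(1) by (auto simp only: symmetric_def)
    then have "- l + - v \<in> label_ball V (Suc n)" unfolding label_ball.simps by blast
    then show ?thesis by (simp add: 2(1))
  qed
qed simp

lemma generatingI:
  assumes V: "symmetric V"
    and e: "(1,0,0) \<in> label_ball V n1" "(0,1,0) \<in> label_ball V n2" "(0,0,1) \<in> label_ball V n3"
  shows "generating V"
proof -
  define S where "S = {k. \<exists>n. k \<in> label_ball V n}"
  have add: "k + l \<in> S" if "k \<in> S" "l \<in> S" for k l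
    using that label_ball_add unfolding S_def by blast
  have minus: "- k \<in> S" if "k \<in> S" for k
    using that label_ball_minus[OF V] unfolding S_def by blast
  have zero: "0 \<in> S" unfolding S_def by (intro CollectI exI[of _ 0]) simp
  define scale where "scale i k = (case k of (x, y, z) \<Rightarrow> (i * x, i * y, i * z))" for i :: int and k :: ivec
  have mult: "scale i k \<in> S" if k: "k \<in> S" for i k
  proof -
    have nat: "scale (int n) k \<in> S" for n
    proof (induction n)
      case 0
      have "scale (int 0) k = 0" by (cases k) (simp add: scale_def zero_prod_def)
      then show ?case using zero by (simp only:)
    next
      case (Suc n)
      have "scale (int (Suc n)) k = scale (int n) k + k"
        by (cases k) (simp add: scale_def algebra_simps)
      then show ?case using add[OF Suc k] by (simp only:)
    qed
    have "scale i k = scale (int (nat i)) k \<or> scale i k = - scale (int (nat (- i))) k"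
      by (cases k; cases "i \<ge> 0") (simp_all add: scale_def)
    then show ?thesis using nat minus by metis
  qed
  have "k \<in> S" for k
  proof -
    obtain x y z where k: "k = (x, y, z)" by (cases k)
    have "(1,0,0) \<in> S" "(0,1,0) \<in> S" "(0,0,1) \<in> S" using e unfolding S_def by blast+
    then have "scale x (1,0,0) + scale y (0,1,0) + scale z (0,0,1) \<in> S"
      by (intro add mult)
    then show ?thesis by (simp add: scale_def k)
  qed
  then show ?thesis unfolding S_def generating_def by blast
qed

text \<open>Balls are computed as lexicographically sorted lists. Translations preserve this order, so the next
  larger ball is a merge of translated copies; this takes far fewer comparisons than removing
  duplicates from an unsorted list.\<close>
fun lex_less :: "ivec \<Rightarrow> ivec \<Rightarrow> bool" where
  "lex_less (x,y,z) (x',y',z') \<longleftrightarrow> x < x' \<or> x = x' \<and> (y < y' \<or> y = y' \<and> z < z')"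

lemma lex_less_trans: "lex_less k l \<Longrightarrow> lex_less l m \<Longrightarrow> lex_less k m"
  by (cases k; cases l; cases m) auto

lemma lex_less_irrefl: "\<not> lex_less k k"
  by (cases k) simp

lemma lex_less_linear: "lex_less k l \<or> k = l \<or> lex_less l k"
  by (cases k; cases l) auto

lemma lex_less_add: "lex_less (v + k) (v + l) \<longleftrightarrow> lex_less k l"
  by (cases k; cases l; cases v) simp

fun merge :: "ivec list \<Rightarrow> ivec list \<Rightarrow> ivec list" where
  "merge [] ys = ys"
| "merge (x # xs) [] = x # xs"
| "merge (x # xs) (y # ys) = (if x = y then x # merge xs ys
     else if lex_less x y then x # merge xs (y # ys) else y # merge (x # xs) ys)"

lemma set_merge: "set (merge xs ys) = set xs \<union> set ys"
  by (induction xs ys rule: merge.induct) auto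

lemma sorted_merge:
  assumes "sorted_wrt lex_less xs" "sorted_wrt lex_less ys"
  shows "sorted_wrt lex_less (merge xs ys)"
  using assms
proof (induction xs ys rule: merge.induct)
  case (3 x xs y ys)
  show ?case
  proof (cases "x = y")
    case True
    then show ?thesis using 3 by (auto simp: set_merge)
  next
    case ne: False
    show ?thesis
    proof (cases "lex_less x y")
      case True
      then have "\<forall>z\<in>set (merge xs (y # ys)). lex_less x z"
        using "3.prems" True by (auto simp: set_merge intro: lex_less_trans[OF True])
      then show ?thesis using 3 ne True by simp
    next
      case False
      then have less: "lex_less y x" using lex_less_linear ne by blast
      then have "\<forall>z\<in>set (merge (x # xs) ys). lex_less y z"
        using "3.prems" less by (auto simp: set_merge intro: lex_less_trans[OF less])
      then show ?thesis using 3 ne False by simp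
    qed
  qed
qed auto

definition grow :: "ivec list \<Rightarrow> ivec list \<Rightarrow> ivec list" where
  "grow vs B = foldr (\<lambda>v. merge (map ((+) v) B)) vs B"

primrec ball_list :: "ivec list \<Rightarrow> nat \<Rightarrow> ivec list" where
  "ball_list vs 0 = [0]"
| "ball_list vs (Suc n) = grow vs (ball_list vs n)"

lemma set_grow: "set (grow vs B) = set B \<union> {k + v | k v. k \<in> set B \<and> v \<in> set vs}"
proof -
  have "set (foldr (\<lambda>v. merge (map ((+) v) B)) vs C) = set C \<union> {k + v | k v. k \<in> set B \<and> v \<in> set vs}" for C
  proof (induction vs)
    case (Cons v vs)
    have "(+) v ` set B = {k + w | k w. k \<in> set B \<and> w \<in> {v}}" by (auto simp: add.commute)
    then show ?case by (auto simp: set_merge Cons)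
  qed simp
  then show ?thesis unfolding grow_def .
qed

lemma sorted_grow:
  assumes B: "sorted_wrt lex_less B" shows "sorted_wrt lex_less (grow vs B)"
proof -
  have shift: "sorted_wrt lex_less (map ((+) v) B)" for v
    using B by (simp add: sorted_wrt_map lex_less_add)
  have "sorted_wrt lex_less (foldr (\<lambda>v. merge (map ((+) v) B)) vs C)" if "sorted_wrt lex_less C" for C
    using that by (induction vs) (simp_all add: sorted_merge shift)
  then show ?thesis unfolding grow_def using B .
qed

definition signed :: "ivec list \<Rightarrow> ivec list" where
  "signed xs = xs @ map uminus xs"

lemma set_signed: "set (signed xs) = label_set xs"
  by (auto simp: signed_def label_set_def)

lemma set_ball_list: "set (ball_list vs n) = label_ball (set vs) n"
  by (induction n) (simp_all add: set_grow)

lemma distinct_if_lex_sorted: "sorted_wrt lex_less ks \<Longrightarrow> distinct ks"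
proof (induction ks)
  case (Cons k ks)
  then have "k \<notin> set ks" using lex_less_irrefl by (metis sorted_wrt.simps(2))
  with Cons show ?case by simp
qed simp

lemma distinct_ball_list: "distinct (ball_list vs n)"
  by (rule distinct_if_lex_sorted, induction n) (simp_all add: sorted_grow)

lemma card_label_ball: "card (label_ball (label_set xs) n) = length (ball_list (signed xs) n)"
  using distinct_card[OF distinct_ball_list[of "signed xs" n]] by (simp add: set_ball_list set_signed)

definition triangular :: "ivec list \<Rightarrow> bool" where
  "triangular vs = list_ex (\<lambda>u. list_ex (\<lambda>v. list_ex ((=) (u + v)) vs) vs) vs"

text \<open>The sizes of three balls separate all models except for two with four loops (sizes 9, 35, 91), of
  which only one has triangles.\<close>
definition signature :: "ivec list \<Rightarrow> nat \<times> nat \<times> nat \<times> bool" where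
  "signature xs = (length (ball_list (signed xs) 1), length (ball_list (signed xs) 2),
     length (ball_list (signed xs) 3), triangular (signed xs))"

text \<open>For a list \<open>B\<close> of the ball of radius 2, this says that \<open>e\<close> lies in the ball of radius 4, which is not
  computed. Radius 3 is too small for the first model.\<close>
definition reaches :: "ivec list \<Rightarrow> ivec \<Rightarrow> bool" where
  "reaches B e = list_ex (\<lambda>k. list_ex ((=) (e - k)) B) B"

definition good_model :: "ivec list \<Rightarrow> bool" where
  "good_model xs \<longleftrightarrow> list_all (\<lambda>v. depth_one v \<and> v \<noteq> 0) xs \<and>
     list_all (\<lambda>v. list_all (\<lambda>w. even_ivec (v - w) \<longrightarrow> w = v \<or> w = - v) (signed xs)) (signed xs) \<and>
     list_all (reaches (ball_list (signed xs) 2)) [(1,0,0), (0,1,0), (0,0,1)]"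

lemma good_models: "list_all good_model model_labels"
  by code_simp

lemma signatures_distinct: "distinct (map signature model_labels)"
  by code_simp

lemma symmetric_label_set: "symmetric (label_set xs)"
proof -
  have "- v \<in> label_set xs" if "v \<in> label_set xs" for v
    using that unfolding label_set_def
  proof (elim UnE imageE)
    fix w assume "v = - w" "w \<in> set xs"
    then show "- v \<in> set xs \<union> uminus ` set xs" by simp
  qed blast
  then show ?thesis unfolding symmetric_def by blast
qed

lemma model_labels_admissible_generating:
  assumes "xs \<in> set model_labels"
  shows "admissible (label_set xs)" "generating (label_set xs)"
proof -
  have good: "good_model xs"
    using good_models assms by (simp add: list_all_iff)
  then have depth: "\<forall>v\<in>set xs. depth_one v \<and> v \<noteq> 0"
    and cross: "\<forall>v\<in>set (signed xs). \<forall>w\<in>set (signed xs). even_ivec (v - w) \<longrightarrow> w = v \<or> w = - v"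
    and reach: "reaches (ball_list (signed xs) 2) (1,0,0)" "reaches (ball_list (signed xs) 2) (0,1,0)"
      "reaches (ball_list (signed xs) 2) (0,0,1)"
    unfolding good_model_def list_all_iff list.set ball_simps simp_thms by - (elim conjE, assumption)+
  have "depth_one v \<and> v \<noteq> 0" if "v \<in> label_set xs" for v
    using that unfolding label_set_def
  proof (elim UnE imageE)
    assume "v \<in> set xs" then show ?thesis using depth by blast
  next
    fix w assume w: "v = - w" "w \<in> set xs"
    then have "depth_one w \<and> w \<noteq> 0" using depth by blast
    then show ?thesis unfolding w(1) by (cases w) (auto simp: depth_one_def zero_prod_def)
  qed
  then show "admissible (label_set xs)"
    using cross symmetric_label_set[of xs] unfolding admissible_def noncrossing_def set_signed by blast
  have "e \<in> label_ball (label_set xs) (2 + 2)" if e: "reaches (ball_list (signed xs) 2) e" for e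
  proof -
    obtain k where "k \<in> set (ball_list (signed xs) 2)" "e - k \<in> set (ball_list (signed xs) 2)"
      using e unfolding reaches_def list_ex_iff by blast
    then have "k + (e - k) \<in> label_ball (label_set xs) (2 + 2)"
      unfolding set_ball_list set_signed by (rule label_ball_add)
    then show ?thesis by simp
  qed
  from generatingI[OF symmetric_label_set this[OF reach(1)] this[OF reach(2)] this[OF reach(3)]]
  show "generating (label_set xs)" .
qed

definition standard_net :: "ivec list \<Rightarrow> net" where
  "standard_net xs = bouquet 0 (mat 1) (label_set xs)"

lemma det_mat_1: "det (mat 1 :: real^3^3) \<noteq> 0"
  by simp

lemma isotopic_standard_nets_signature:
  assumes "periodically_isotopic (standard_net xs) (standard_net ys)"
  shows "signature xs = signature ys"
proof -
  note inv = isotopic_bouquets_invariants[OF assms[unfolded standard_net_def] det_mat_1 det_mat_1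
      symmetric_label_set symmetric_label_set]
  have len: "length (ball_list (signed xs) n) = length (ball_list (signed ys) n)" for n
    using inv(1)[of n] unfolding card_label_ball .
  have tri: "triangular (signed zs) \<longleftrightarrow> (\<exists>u\<in>label_set zs. \<exists>v\<in>label_set zs. u + v \<in> label_set zs)" for zs
    unfolding triangular_def list_ex_iff set_signed by blast
  show ?thesis
    unfolding signature_def len tri inv(2) ..
qed

theorem corollary9p6:
  shows "card ({M :: net. linear_net M \<and> connected_net M \<and> adjacency_depth M = 1 \<and>
                  (\<exists>G. quotient_graph_of M G \<and> card (gverts G) = 1)}
               // {(M, M'). periodically_isotopic M M'}) = 19"
proof -
  let ?R = "{(M, M'). periodically_isotopic M M'}"
  let ?C = "\<lambda>xs. ?R `` {standard_net xs}"
  have std: "standard_net xs \<in> target_nets" if "xs \<in> set model_labels" for xs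
    unfolding standard_net_def
    using bouquet_target_nets[OF det_mat_1] model_labels_admissible_generating[OF that] by blast
  have "target_nets // ?R = ?C ` set model_labels"
  proof (intro equalityI subsetI)
    fix X assume "X \<in> target_nets // ?R"
    then obtain M where M: "M \<in> target_nets" "X = ?R `` {M}" by (rule quotientE)
    obtain p a V where V: "M = bouquet p a V" "det a \<noteq> 0" "admissible V" "generating V"
      using M(1) by (rule target_nets_bouquet)
    obtain xs where xs: "xs \<in> set model_labels" "equivalent_labels (label_set xs) V"
      using equivalent_to_model[OF V(3,4)] by blast
    have "periodically_isotopic M N \<longleftrightarrow> periodically_isotopic (standard_net xs) N" for N
      unfolding V(1) standard_net_def
      by (rule isotopic_bouquet_equivalent[OF xs(2) V(2) symmetric_label_set])
    then have "X = ?C xs" unfolding M(2) Image_singleton by simp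
    then show "X \<in> ?C ` set model_labels" using xs(1) by blast
  next
    fix X assume "X \<in> ?C ` set model_labels"
    then obtain xs where xs: "xs \<in> set model_labels" "X = ?C xs" by blast
    show "X \<in> target_nets // ?R" unfolding xs(2) by (rule quotientI[OF std[OF xs(1)]])
  qed
  moreover have "inj_on ?C (set model_labels)"
  proof (rule inj_onI)
    fix xs ys assume xs: "xs \<in> set model_labels" and ys: "ys \<in> set model_labels" and eq: "?C xs = ?C ys"
    have "linear_net (standard_net ys)" using std[OF ys] unfolding target_nets_def by blast
    then have "standard_net ys \<in> ?C ys" using isotopic_refl by blast
    then have "periodically_isotopic (standard_net xs) (standard_net ys)" unfolding eq[symmetric] by blast
    then have "signature xs = signature ys" by (rule isotopic_standard_nets_signature)
    moreover have "inj_on signature (set model_labels)" using signatures_distinct by (simp add: distinct_map)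
    ultimately show "xs = ys" using xs ys by (simp add: inj_on_eq_iff)
  qed
  then have "card (?C ` set model_labels) = card (set model_labels)" by (rule card_image)
  moreover have "card (set model_labels) = length model_labels"
    using signatures_distinct by (intro distinct_card) (simp add: distinct_map)
  moreover have "length model_labels = 19" by (simp add: model_labels_def)
  ultimately show ?thesis unfolding target_nets_def by simp
qed

end
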